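(* Let $m\ge3$, let $s,s'\in\mathbb C$, and let $v,t$ be $2m$-closed initial data for circle intersection dynamics such that $v_i=s$ and $t_i=s'$ for all $i\in2\mathbb Z$. Assume that the propagation map $T$ can be applied at least $m-1$ times. Then there are $s'',s'''\in\hat{\mathbb C}$ such that $$\tilde z_m\equiv s'',\qquad \tilde w_m\equiv s''' .$$ That is, the singularity repeats after $m-1$ steps.
   Context: $\hat{\mathbb C}=\mathbb C\cup\{\infty\}$. Initial data for circle intersection dynamics consist of points $(v_i)_{i\in\mathbb Z}$ in $\mathbb C$ and centers $(t_i)_{i\in\mathbb Z}$ such that $v_{i-1},v_i,v_{i+1}$ lie on a circle $c_i$ with center $t_i$ (generically the points determine the centers, but for singular data they are prescribed separately). They are $2m$-closed if $v_{i+2m}=v_i$ and $t_{i+2m}=t_i$ for all $i$. Set, for even $i$, $\tilde z_{i,0}=v_i$, $\tilde w_{i,0}=t_i$, and for odd $i$, $\tilde w_{i,1}=v_i$, $\tilde z_{i,1}=t_i$. The propagation map $T:(\tilde z_j,\tilde w_j,\tilde z_{j+1},\tilde w_{j+1})\mapsto(\tilde z_{j+1},\tilde w_{j+1},\tilde z_{j+2},\tilde w_{j+2})$, where $\tilde z_j=(\tilde z_{i,j})_{i\equiv j \bmod 2}$ and similarly for $\tilde w_j$, is defined as follows. If $j$ is even (and $i$ even): $\tilde z_{i,j+2}$ is the intersection point other than $\tilde z_{i,j}$ of the circles centered at $\tilde z_{i-1,j+1}$ and $\tilde z_{i+1,j+1}$ passing through $\tilde z_{i,j}$, and $\tilde w_{i,j+2}$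 is the center of the circle through $\tilde w_{i-1,j+1},\tilde w_{i+1,j+1},\tilde z_{i,j+2}$. If $j$ is odd (and $i$ odd): the same with the roles of $\tilde z$ and $\tilde w$ exchanged. "$\tilde z_m\equiv s''$" means that the row is constant. "$T$ can be applied" means that these steps are well defined; standing assumption: the data are as generic as possible given the initial singularity. *)

theory Defs
  imports "HOL-Analysis.Analysis"
begin

datatype ext_complex = Fin complex | Infty

text \<open>Circles in the extended plane. Straight lines, completed by the point at infinity, are
  the circles with center infinity; such a circle is not determined by its center and one point.\<close>

primrec circle_with_center :: "ext_complex \<Rightarrow> ext_complex set \<Rightarrow> bool" where
  "circle_with_center (Fin c) C \<longleftrightarrow> (\<exists>r>0. C = Fin ` sphere c r)"
| "circle_with_center Infty C \<longleftrightarrow> (\<exists>a b. a \<noteq> b \<and> C = insert Infty (Fin ` (affine hull {a, b})))"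

definition other_intersection ::
  "ext_complex \<Rightarrow> ext_complex \<Rightarrow> ext_complex \<Rightarrow> ext_complex \<Rightarrow> bool" where
  "other_intersection a b p x \<longleftrightarrow>
     (\<exists>A B. circle_with_center a A \<and> circle_with_center b B \<and>
            p \<in> A \<inter> B \<and> x \<in> A \<inter> B \<and> x \<noteq> p)"

definition center_of_circle_through ::
  "ext_complex \<Rightarrow> ext_complex \<Rightarrow> ext_complex \<Rightarrow> ext_complex \<Rightarrow> bool" where
  "center_of_circle_through p q r c \<longleftrightarrow> (\<exists>C. circle_with_center c C \<and> {p, q, r} \<subseteq> C)"

definition initial_data :: "(int \<Rightarrow> complex) \<Rightarrow> (int \<Rightarrow> complex) \<Rightarrow> bool" where
  "initial_data v t \<longleftrightarrow> (\<forall>i. \<exists>r>0. {v (i - 1), v i, v (i + 1)} \<subseteq> sphere (t i) r)"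

definition closed_data :: "nat \<Rightarrow> (int \<Rightarrow> complex) \<Rightarrow> (int \<Rightarrow> complex) \<Rightarrow> bool" where
  "closed_data n v t \<longleftrightarrow> (\<forall>i. v (i + int n) = v i \<and> t (i + int n) = t i)"

text \<open>Of the row with number \<open>j\<close> only the entries at indices \<open>i\<close> with the same parity as \<open>j\<close>
  are meaningful; the others are arbitrary and never used. A state consists of the rows
  \<open>(z\<^sub>j, w\<^sub>j, z\<^sub>j\<^sub>+\<^sub>1, w\<^sub>j\<^sub>+\<^sub>1)\<close>.\<close>

type_synonym row = "int \<Rightarrow> ext_complex"
type_synonym state = "row \<times> row \<times> row \<times> row"

definition row_index :: "nat \<Rightarrow> int \<Rightarrow> bool" where
  "row_index j i \<longleftrightarrow> even (i - int j)"

definition initial_state :: "(int \<Rightarrow> complex) \<Rightarrow> (int \<Rightarrow> complex) \<Rightarrow> state" where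
  "initial_state v t = (\<lambda>i. Fin (v i), \<lambda>i. Fin (t i), \<lambda>i. Fin (t i), \<lambda>i. Fin (v i))"

text \<open>One step with generic roles: \<open>p\<close> is the row of intersection points that gets replaced,
  \<open>c\<close> the next row of the same letter (circle centers), and \<open>q\<close> the next row of the other
  letter (intersection points).\<close>

definition new_points :: "row \<Rightarrow> row \<Rightarrow> row" where
  "new_points p c = (\<lambda>i. THE x. other_intersection (c (i - 1)) (c (i + 1)) (p i) x)"

definition new_centers :: "row \<Rightarrow> row \<Rightarrow> row" where
  "new_centers q p' = (\<lambda>i. THE x. center_of_circle_through (q (i - 1)) (q (i + 1)) (p' i) x)"

text \<open>Unique existence expresses that a construction is well defined. It excludes coinciding or
  tangent circles, centers at infinity of the circles to be intersected, and coincidences among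
  the three points through which a circle is drawn. Three distinct collinear points are allowed;
  the center is then infinity.\<close>

definition step_defined :: "nat \<Rightarrow> row \<Rightarrow> row \<Rightarrow> row \<Rightarrow> bool" where
  "step_defined j p c q \<longleftrightarrow> (\<forall>i. row_index j i \<longrightarrow>
     (\<exists>!x. other_intersection (c (i - 1)) (c (i + 1)) (p i) x) \<and>
     (\<exists>!x. center_of_circle_through (q (i - 1)) (q (i + 1)) (new_points p c i) x))"

definition T :: "nat \<Rightarrow> state \<Rightarrow> state option" where
  "T j = (\<lambda>(z\<^sub>0, w\<^sub>0, z\<^sub>1, w\<^sub>1).
     if even j then
       (if step_defined j z\<^sub>0 z\<^sub>1 w\<^sub>1
        then (let z\<^sub>2 = new_points z\<^sub>0 z\<^sub>1 in Some (z\<^sub>1, w\<^sub>1, z\<^sub>2, new_centers w\<^sub>1 z\<^sub>2))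
        else None)
     else
       (if step_defined j w\<^sub>0 w\<^sub>1 z\<^sub>1
        then (let w\<^sub>2 = new_points w\<^sub>0 w\<^sub>1 in Some (z\<^sub>1, w\<^sub>1, new_centers z\<^sub>1 w\<^sub>2, w\<^sub>2))
        else None))"

primrec T_iter :: "nat \<Rightarrow> state \<Rightarrow> state option" where
  "T_iter 0 S = Some S"
| "T_iter (Suc k) S = Option.bind (T_iter k S) (T k)"

definition constant_row :: "nat \<Rightarrow> row \<Rightarrow> ext_complex \<Rightarrow> bool" where
  "constant_row j x a \<longleftrightarrow> (\<forall>i. row_index j i \<longrightarrow> x i = a)"

end

theory Submission
  imports Defs "HOL-Computational_Algebra.Polynomial"
begin

text \<open>Invert at \<open>s\<close>: the circle centered at \<open>s'\<close> and the circles with odd index become lines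
  \<open>l, L\<^sub>1, L\<^sub>3, \<dots>, L\<^sub>2\<^sub>m\<^sub>-\<^sub>1\<close>, and the dynamics builds Clifford's chain of circle theorems on
  them. The point \<open>P\<^sub>i\<^sub>,\<^sub>j\<close> is the Clifford point of the \<open>j\<close> consecutive lines
  around \<open>L\<^sub>i\<close>, together with \<open>l\<close> if \<open>j\<close> is odd; the circle around \<open>C\<^sub>i\<^sub>,\<^sub>j\<close> is the
  Clifford circle of the same lines, with \<open>l\<close> if \<open>j\<close> is even. For \<open>j = m\<close> all the lines occur,
  so the index \<open>i\<close> no longer matters.

  Clifford points are obtained by rational interpolation. A circle through the origin with center
  \<open>\<tau>\<close> is the set of \<open>\<zeta> = 1 / u\<close> with \<open>u + ang \<tau> * cnj u = 1 / \<tau>\<close>. Let \<open>B / A\<close> be the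
  rational function of type \<open>(n + 1, n)\<close> with the value \<open>1 / \<tau>\<close> at \<open>ang \<tau>\<close> for
  \<open>2 * n + 2\<close> nodes \<open>\<tau>\<close>; its value at \<open>0\<close> is the Clifford point. With one node less the
  interpolants form a pencil, and the symmetry under reflection in the unit circle singles
  out a real projective line in it, whose values at \<open>0\<close> fill the Clifford circle.\<close>

section \<open>Polynomials symmetric under reflection in the unit circle\<close>

text \<open>Equivalently, the coefficients satisfy \<open>cnj a\<^sub>n\<^sub>-\<^sub>i = \<kappa> * a\<^sub>i\<close>; the factor \<open>\<kappa>\<close>
  makes the notion projective.\<close>

definition hermitian_poly :: "nat \<Rightarrow> complex \<Rightarrow> complex poly \<Rightarrow> bool" where
  "hermitian_poly n \<kappa> A \<longleftrightarrow> degree A \<le> n \<and>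
     (\<forall>t. t \<noteq> 0 \<longrightarrow> t ^ n * cnj (poly A (inverse (cnj t))) = \<kappa> * poly A t)"

lemma hermitian_poly_mult:
  assumes "hermitian_poly n \<kappa> A" "hermitian_poly k \<mu> B"
  shows "hermitian_poly (n + k) (\<kappa> * \<mu>) (A * B)"
proof -
  have "degree (A * B) \<le> n + k"
    using assms degree_mult_le[of A B] by (auto simp: hermitian_poly_def)
  moreover have "t ^ (n + k) * cnj (poly (A * B) (inverse (cnj t))) = (\<kappa> * \<mu>) * poly (A * B) t"
    if "t \<noteq> 0" for t
  proof -
    have "t ^ (n + k) * cnj (poly (A * B) (inverse (cnj t))) =
      (t ^ n * cnj (poly A (inverse (cnj t)))) * (t ^ k * cnj (poly B (inverse (cnj t))))"
      by (simp add: power_add)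
    also have "\<dots> = (\<kappa> * poly A t) * (\<mu> * poly B t)"
      using assms that by (simp add: hermitian_poly_def)
    finally show ?thesis by simp
  qed
  ultimately show ?thesis by (simp add: hermitian_poly_def)
qed

lemma hermitian_poly_diff:
  assumes "hermitian_poly n \<kappa> A" "hermitian_poly n \<kappa> B"
  shows "hermitian_poly n \<kappa> (A - B)"
  using assms by (auto simp: hermitian_poly_def degree_diff_le ring_distribs)

text \<open>Scaling by \<open>\<alpha>\<close> changes the factor from \<open>\<kappa>1\<close> to
  \<open>cnj \<alpha> * \<kappa>1 / \<alpha>\<close>. The last two hypotheses bring both terms to
  the common factor \<open>\<kappa>\<close>; written without division they also admit vanishing
  coefficients.\<close>

lemma hermitian_poly_combination:
  assumes "hermitian_poly n \<kappa>1 A" "hermitian_poly n \<kappa>2 B"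
    and "cnj \<alpha> * \<kappa>1 = \<kappa> * \<alpha>" "cnj \<beta> * \<kappa>2 = \<kappa> * \<beta>"
  shows "hermitian_poly n \<kappa> (smult \<alpha> A + smult \<beta> B)"
proof -
  have "t ^ n * cnj (poly (smult \<alpha> A + smult \<beta> B) (inverse (cnj t))) =
      \<kappa> * poly (smult \<alpha> A + smult \<beta> B) t" if "t \<noteq> 0" for t
  proof -
    have "t ^ n * cnj (poly (smult \<alpha> A + smult \<beta> B) (inverse (cnj t))) =
      cnj \<alpha> * (t ^ n * cnj (poly A (inverse (cnj t)))) + cnj \<beta> * (t ^ n * cnj (poly B (inverse (cnj t))))"
      by (simp add: algebra_simps)
    also have "\<dots> = (cnj \<alpha> * \<kappa>1) * poly A t + (cnj \<beta> * \<kappa>2) * poly B t"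
      using assms(1,2) that by (simp add: hermitian_poly_def)
    also have "\<dots> = \<kappa> * poly (smult \<alpha> A + smult \<beta> B) t"
      unfolding assms(3,4) by (simp add: algebra_simps)
    finally show ?thesis .
  qed
  moreover have "degree (smult \<alpha> A + smult \<beta> B) \<le> n"
    using assms by (auto simp: hermitian_poly_def intro!: degree_add_le order.trans[OF degree_smult_le])
  ultimately show ?thesis by (simp add: hermitian_poly_def)
qed

lemma hermitian_poly_linear:
  assumes "cnj a * a = 1"
  shows "hermitian_poly 1 (- cnj a) [:- a, 1:]"
  using assms by (auto simp: hermitian_poly_def field_simps)

text \<open>\<open>R\<close> has the conjugated coefficients of \<open>A\<close> in reverse order.
  It agrees with \<open>smult \<kappa> A\<close> away from 0, hence as a polynomial, and its
  coefficient of degree \<open>n\<close> ties the value at 0 to the top coefficient.\<close>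

lemma hermitian_poly_coeffs:
  assumes "hermitian_poly n \<kappa> A"
  shows "cnj (poly A 0) = \<kappa> * coeff A n"
proof -
  define R where "R = (\<Sum>i\<le>n. monom (cnj (coeff A (n - i))) i)"
  have R: "poly R t = \<kappa> * poly A t" if t: "t \<noteq> 0" for t
  proof -
    have A: "A = (\<Sum>i\<le>n. monom (coeff A i) i)"
      using assms by (simp add: hermitian_poly_def poly_as_sum_of_monoms')
    have "cnj (poly A (inverse (cnj t))) = (\<Sum>i\<le>n. cnj (coeff A i) * inverse t ^ i)"
      by (subst A) (simp add: poly_sum poly_monom)
    then have "t ^ n * cnj (poly A (inverse (cnj t))) = (\<Sum>i\<le>n. cnj (coeff A i) * t ^ (n - i))"
      using t by (auto simp: sum_distrib_left power_diff field_simps intro!: sum.cong)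
    also have "\<dots> = (\<Sum>i\<le>n. cnj (coeff A (n - i)) * t ^ i)"
      by (rule sum.reindex_bij_witness[of _ "\<lambda>i. n - i" "\<lambda>i. n - i"]) auto
    also have "\<dots> = poly R t"
      by (simp add: R_def poly_sum poly_monom)
    finally show ?thesis
      using assms t by (simp add: hermitian_poly_def)
  qed
  have "R = smult \<kappa> A"
  proof (rule ccontr)
    assume "R \<noteq> smult \<kappa> A"
    then have "finite {t. poly (R - smult \<kappa> A) t = 0}"
      by (intro poly_roots_finite) simp
    moreover have "- {0} \<subseteq> {t. poly (R - smult \<kappa> A) t = 0}"
      using R by auto
    ultimately have "finite (- {0 :: complex})" by (rule rev_finite_subset)
    then show False by (simp add: infinite_UNIV_char_0)
  qed
  then have "coeff R n = \<kappa> * coeff A n" by simp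
  moreover have "coeff R n = cnj (coeff A 0)"
    by (simp add: R_def coeff_sum if_distrib sum.delta cong: if_cong)
  ultimately show ?thesis by (simp add: poly_0_coeff_0)
qed

section \<open>Counting roots\<close>

lemma poly_eq_0_if_many_roots:
  fixes p :: "complex poly"
  assumes "degree p \<le> n" "finite S" "card S > n" "\<And>x. x \<in> S \<Longrightarrow> poly p x = 0"
  shows "p = 0"
proof (rule ccontr)
  assume "p \<noteq> 0"
  then have "card S \<le> card {x. poly p x = 0}"
    using assms by (intro card_mono poly_roots_finite) auto
  also have "\<dots> \<le> degree p" using \<open>p \<noteq> 0\<close> by (rule card_poly_roots_bound)
  finally show False using assms by simp
qed

lemma degree_le_if_top_coeff_0:
  assumes "degree p \<le> Suc n" "coeff p (Suc n) = 0"
  shows "degree p \<le> n"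
proof (rule degree_le, intro allI impI)
  fix i assume "n < i"
  show "coeff p i = 0"
  proof (cases "i = Suc n")
    case False
    then have "degree p < i" using \<open>n < i\<close> assms by linarith
    then show ?thesis by (rule coeff_eq_0)
  qed (use assms in simp)
qed

section \<open>Rational interpolation at nodes on the unit circle\<close>

text \<open>For nonzero \<open>\<tau>\<close> this point of the unit circle records the direction of
  the line through 0 and \<open>\<tau>\<close>. Two different circles through 0 have centers with
  equal \<open>ang\<close> exactly when they touch there.\<close>

definition ang :: "complex \<Rightarrow> complex" where
  "ang \<tau> = cnj \<tau> / \<tau>"

lemma ang_nonzero: "\<tau> \<noteq> 0 \<Longrightarrow> ang \<tau> \<noteq> 0"
  by (simp add: ang_def)

lemma cnj_ang_mult_ang: "\<tau> \<noteq> 0 \<Longrightarrow> cnj (ang \<tau>) * ang \<tau> = 1"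
  by (simp add: ang_def)

definition good_nodes :: "nat \<Rightarrow> complex set \<Rightarrow> bool" where
  "good_nodes k S \<longleftrightarrow> finite S \<and> card S = k \<and> 0 \<notin> S \<and> inj_on ang S"

text \<open>The conditions \<open>B / A = 1 / \<tau>\<close> are cleared of denominators, so
  \<open>A\<close> and \<open>B\<close> may vanish together at a node. The shared
  \<open>\<kappa>\<close> gives \<open>f = B / A\<close> the symmetry
  \<open>t * cnj (f (inverse (cnj t))) = f t\<close>.\<close>

definition interpolant :: "nat \<Rightarrow> complex set \<Rightarrow> complex \<Rightarrow> complex poly \<Rightarrow> complex poly \<Rightarrow> bool" where
  "interpolant n S \<kappa> A B \<longleftrightarrow> \<kappa> \<noteq> 0 \<and> hermitian_poly n \<kappa> A \<and> hermitian_poly (Suc n) \<kappa> B \<and>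
     (\<forall>\<tau>\<in>S. \<tau> * poly B (ang \<tau>) = poly A (ang \<tau>))"

text \<open>Points are written as \<open>1 / u\<close>, so the value is that of \<open>A / B\<close>
  at 0; \<open>poly B 0 \<noteq> 0\<close> makes it finite.\<close>

definition clifford_value :: "nat \<Rightarrow> complex set \<Rightarrow> complex \<Rightarrow> bool" where
  "clifford_value n S \<zeta> \<longleftrightarrow>
     (\<exists>\<kappa> A B. interpolant n S \<kappa> A B \<and> poly B 0 \<noteq> 0 \<and> poly A 0 = \<zeta> * poly B 0)"

lemma clifford_value_mono:
  assumes "clifford_value n S \<zeta>" "S' \<subseteq> S"
  shows "clifford_value n S' \<zeta>"
  using assms unfolding clifford_value_def interpolant_def by blast

text \<open>Multiplying both polynomials by the linear factor with root \<open>ang \<tau>\<close>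
  reduces the new condition to 0 = 0 and keeps the quotient at 0. Geometrically, a Clifford point
  lies on the Clifford circle of the same lines and one more.\<close>

lemma clifford_value_insert:
  assumes "clifford_value n S \<zeta>" "\<tau> \<noteq> 0"
  shows "clifford_value (Suc n) (insert \<tau> S) \<zeta>"
proof -
  obtain \<kappa> A B where AB: "interpolant n S \<kappa> A B" "poly B 0 \<noteq> 0" "poly A 0 = \<zeta> * poly B 0"
    using assms by (auto simp: clifford_value_def)
  let ?l = "[:- ang \<tau>, 1:]"
  have l: "hermitian_poly 1 (- cnj (ang \<tau>)) ?l"
    by (rule hermitian_poly_linear[OF cnj_ang_mult_ang[OF assms(2)]])
  have "interpolant (Suc n) (insert \<tau> S) (- cnj (ang \<tau>) * \<kappa>) (?l * A) (?l * B)"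
    unfolding interpolant_def
  proof (intro conjI ballI)
    show "- cnj (ang \<tau>) * \<kappa> \<noteq> 0"
      using AB(1) ang_nonzero[OF assms(2)] by (simp add: interpolant_def)
    show "hermitian_poly (Suc n) (- cnj (ang \<tau>) * \<kappa>) (?l * A)"
      using AB(1) hermitian_poly_mult[OF l, of n \<kappa> A] by (simp add: interpolant_def)
    show "hermitian_poly (Suc (Suc n)) (- cnj (ang \<tau>) * \<kappa>) (?l * B)"
      using AB(1) hermitian_poly_mult[OF l, of "Suc n" \<kappa> B] by (simp add: interpolant_def)
    show "\<tau>' * poly (?l * B) (ang \<tau>') = poly (?l * A) (ang \<tau>')" if "\<tau>' \<in> insert \<tau> S" for \<tau>'
    proof (cases "\<tau>' = \<tau>")
      case False
      then have "\<tau>' * poly B (ang \<tau>') = poly A (ang \<tau>')"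
        using that AB(1) by (simp add: interpolant_def)
      then show ?thesis unfolding poly_mult by (metis mult.left_commute)
    qed simp
  qed
  moreover have "poly (?l * B) 0 \<noteq> 0" "poly (?l * A) 0 = \<zeta> * poly (?l * B) 0"
    using AB ang_nonzero[OF assms(2)] by auto
  ultimately show ?thesis unfolding clifford_value_def by blast
qed

section \<open>Values of a pencil and real cross ratios\<close>

text \<open>The bracket is the numerator of the difference of \<open>A1 / B1\<close> and
  \<open>A2 / B2\<close>. At 0 it is the difference of the two Clifford values, up to the values of
  \<open>B1\<close> and \<open>B2\<close>.\<close>

lemma hermitian_poly_bracket:
  assumes "interpolant n S \<kappa>1 A1 B1" "interpolant n S' \<kappa>2 A2 B2"
  shows "hermitian_poly (Suc (2 * n)) (\<kappa>1 * \<kappa>2) (A1 * B2 - A2 * B1)"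
proof -
  have "hermitian_poly (Suc (2 * n)) (\<kappa>1 * \<kappa>2) (A1 * B2)"
    using hermitian_poly_mult[of n \<kappa>1 A1 "Suc n" \<kappa>2 B2] assms
    by (simp add: interpolant_def mult_2)
  moreover have "hermitian_poly (Suc (2 * n)) (\<kappa>1 * \<kappa>2) (A2 * B1)"
    using hermitian_poly_mult[of n \<kappa>2 A2 "Suc n" \<kappa>1 B1] assms
    by (simp add: interpolant_def mult_2 mult.commute[of \<kappa>2])
  ultimately show ?thesis by (rule hermitian_poly_diff)
qed

lemma interpolant_bracket_root:
  assumes "interpolant n S \<kappa>1 A1 B1" "interpolant k S' \<kappa>2 A2 B2" "\<tau> \<in> S" "\<tau> \<in> S'"
  shows "poly (A1 * B2 - A2 * B1) (ang \<tau>) = 0"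
proof -
  have "\<tau> * poly B1 (ang \<tau>) = poly A1 (ang \<tau>)" "\<tau> * poly B2 (ang \<tau>) = poly A2 (ang \<tau>)"
    using assms by (auto simp: interpolant_def)
  then show ?thesis by (simp flip: \<open>\<tau> * poly B1 (ang \<tau>) = _\<close> \<open>\<tau> * poly B2 (ang \<tau>) = _\<close>)
qed

text \<open>All brackets vanish at the same \<open>2 * n + 1\<close> nodes, so they are multiples of one polynomial,
  and each has a phase that depends on the factors \<open>\<kappa>\<close> only.\<close>

lemma bracket_phase:
  assumes S: "good_nodes (Suc (2 * n)) S"
    and "interpolant n S \<kappa>1 A1 B1" "interpolant n S \<kappa>2 A2 B2"
    and "interpolant n S \<kappa>3 A3 B3" "interpolant n S \<kappa>4 A4 B4"
  shows "poly (A1 * B2 - A2 * B1) 0 * cnj (poly (A3 * B4 - A4 * B3) 0) * (\<kappa>1 * \<kappa>2) =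
         poly (A3 * B4 - A4 * B3) 0 * cnj (poly (A1 * B2 - A2 * B1) 0) * (\<kappa>3 * \<kappa>4)"
proof -
  define D where "D = A1 * B2 - A2 * B1"
  define E where "E = A3 * B4 - A4 * B3"
  \<comment> \<open>Cancelling the leading terms brings the degree down to \<open>2 * n\<close>, one
    less than the number of nodes.\<close>
  define p where "p = smult (coeff E (Suc (2 * n))) D - smult (coeff D (Suc (2 * n))) E"
  have D: "hermitian_poly (Suc (2 * n)) (\<kappa>1 * \<kappa>2) D"
    unfolding D_def by (rule hermitian_poly_bracket[OF assms(2,3)])
  have E: "hermitian_poly (Suc (2 * n)) (\<kappa>3 * \<kappa>4) E"
    unfolding E_def by (rule hermitian_poly_bracket[OF assms(4,5)])
  have "degree p \<le> Suc (2 * n)"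
    using D E unfolding p_def hermitian_poly_def
    by (auto intro!: degree_diff_le order.trans[OF degree_smult_le])
  moreover have "coeff p (Suc (2 * n)) = 0" by (simp add: p_def)
  ultimately have "degree p \<le> 2 * n" by (rule degree_le_if_top_coeff_0)
  moreover have "poly p x = 0" if "x \<in> ang ` S" for x
    using that interpolant_bracket_root[OF assms(2,3)] interpolant_bracket_root[OF assms(4,5)]
    by (auto simp: p_def D_def[symmetric] E_def[symmetric])
  moreover have "finite (ang ` S)" "card (ang ` S) > 2 * n"
    using S by (auto simp: good_nodes_def card_image)
  ultimately have "p = 0" by (intro poly_eq_0_if_many_roots[of p "2 * n" "ang ` S"]) auto
  then have "poly p 0 = 0" by simp
  then have "coeff E (Suc (2 * n)) * poly D 0 = coeff D (Suc (2 * n)) * poly E 0"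
    by (simp add: p_def)
  then have "poly D 0 * (\<kappa>3 * \<kappa>4 * coeff E (Suc (2 * n))) * (\<kappa>1 * \<kappa>2)
      = poly E 0 * (\<kappa>1 * \<kappa>2 * coeff D (Suc (2 * n))) * (\<kappa>3 * \<kappa>4)"
    by algebra
  then show ?thesis
    by (simp only: hermitian_poly_coeffs[OF D, symmetric] hermitian_poly_coeffs[OF E, symmetric]
      D_def[symmetric] E_def[symmetric])
qed

text \<open>The cross ratio \<open>(x - p) * (r - q) / ((x - q) * (r - p))\<close> is real, cleared
  of denominators. For distinct \<open>p\<close>, \<open>q\<close>, \<open>r\<close> this describes
  the circle or line through them.\<close>

definition real_cross_ratio :: "complex \<Rightarrow> complex \<Rightarrow> complex \<Rightarrow> complex \<Rightarrow> bool" where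
  "real_cross_ratio x p q r \<longleftrightarrow>
     (x - p) * (r - q) * cnj ((x - q) * (r - p)) = cnj ((x - p) * (r - q)) * ((x - q) * (r - p))"

text \<open>Each difference is a bracket at 0 up to nonzero factors. In the cross ratio the phases
  of the four brackets cancel, since every \<open>\<kappa>\<close> occurs equally often on both
  sides.\<close>

lemma real_cross_ratio_clifford_value:
  assumes S: "good_nodes (Suc (2 * n)) S"
    and "clifford_value n S x" "clifford_value n S p" "clifford_value n S q" "clifford_value n S r"
  shows "real_cross_ratio x p q r"
proof -
  obtain \<kappa>1 A1 B1 where 1: "interpolant n S \<kappa>1 A1 B1" "poly B1 0 \<noteq> 0" "poly A1 0 = x * poly B1 0"
    using assms(2) by (auto simp: clifford_value_def)
  obtain \<kappa>2 A2 B2 where 2: "interpolant n S \<kappa>2 A2 B2" "poly B2 0 \<noteq> 0" "poly A2 0 = p * poly B2 0"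
    using assms(3) by (auto simp: clifford_value_def)
  obtain \<kappa>3 A3 B3 where 3: "interpolant n S \<kappa>3 A3 B3" "poly B3 0 \<noteq> 0" "poly A3 0 = q * poly B3 0"
    using assms(4) by (auto simp: clifford_value_def)
  obtain \<kappa>4 A4 B4 where 4: "interpolant n S \<kappa>4 A4 B4" "poly B4 0 \<noteq> 0" "poly A4 0 = r * poly B4 0"
    using assms(5) by (auto simp: clifford_value_def)
  have k: "\<kappa>1 \<noteq> 0" "\<kappa>2 \<noteq> 0" "\<kappa>3 \<noteq> 0" "\<kappa>4 \<noteq> 0"
    using 1 2 3 4 by (auto simp: interpolant_def)
  define b where "b = poly B1 0 * poly B2 0 * poly B3 0 * poly B4 0"
  let ?c = "\<kappa>1 * \<kappa>2 * \<kappa>3 * \<kappa>4 * b * cnj b"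
  note e1 = bracket_phase[OF S 1(1) 2(1) 1(1) 3(1)]
  note e2 = bracket_phase[OF S 4(1) 3(1) 4(1) 2(1)]
  have "?c * ((x - p) * (r - q) * cnj ((x - q) * (r - p))) =
     (poly (A1 * B2 - A2 * B1) 0 * cnj (poly (A1 * B3 - A3 * B1) 0) * (\<kappa>1 * \<kappa>2)) *
     (poly (A4 * B3 - A3 * B4) 0 * cnj (poly (A4 * B2 - A2 * B4) 0) * (\<kappa>4 * \<kappa>3))"
    by (simp add: 1 2 3 4 b_def algebra_simps)
  also have "\<dots> = (poly (A1 * B3 - A3 * B1) 0 * cnj (poly (A1 * B2 - A2 * B1) 0) * (\<kappa>1 * \<kappa>3)) *
     (poly (A4 * B2 - A2 * B4) 0 * cnj (poly (A4 * B3 - A3 * B4) 0) * (\<kappa>4 * \<kappa>2))"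
    by (simp only: e1 e2)
  also have "\<dots> = ?c * (cnj ((x - p) * (r - q)) * ((x - q) * (r - p)))"
    by (simp add: 1 2 3 4 b_def algebra_simps)
  finally show ?thesis
    using k 1 2 3 4 by (simp add: real_cross_ratio_def b_def)
qed

text \<open>A linear combination of the interpolants for \<open>p\<close> and \<open>q\<close> has
  the value \<open>x\<close> at 0. The reality of the cross ratio is what gives its two terms the
  same factor \<open>\<kappa>\<close>.\<close>

lemma clifford_value_if_real_cross_ratio:
  assumes S: "good_nodes (Suc (2 * n)) S"
    and "clifford_value n S p" "clifford_value n S q" "clifford_value n S r"
    and dist: "p \<noteq> q" "p \<noteq> r" "q \<noteq> r"
    and re: "real_cross_ratio x p q r"
  shows "clifford_value n S x"
proof -
  obtain \<kappa>1 A1 B1 where 1: "interpolant n S \<kappa>1 A1 B1" "poly B1 0 \<noteq> 0" "poly A1 0 = p * poly B1 0"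
    using assms(2) by (auto simp: clifford_value_def)
  obtain \<kappa>2 A2 B2 where 2: "interpolant n S \<kappa>2 A2 B2" "poly B2 0 \<noteq> 0" "poly A2 0 = q * poly B2 0"
    using assms(3) by (auto simp: clifford_value_def)
  obtain \<kappa>3 A3 B3 where 3: "interpolant n S \<kappa>3 A3 B3" "poly B3 0 \<noteq> 0" "poly A3 0 = r * poly B3 0"
    using assms(4) by (auto simp: clifford_value_def)
  have k: "\<kappa>1 \<noteq> 0" "\<kappa>2 \<noteq> 0" "\<kappa>3 \<noteq> 0"
    using 1 2 3 by (auto simp: interpolant_def)
  define b1 b2 b3 where "b1 = poly B1 0" and "b2 = poly B2 0" and "b3 = poly B3 0"
  note b = b1_def[symmetric] b2_def[symmetric] b3_def[symmetric]
  have b0: "b1 \<noteq> 0" "b2 \<noteq> 0" "b3 \<noteq> 0" using 1 2 3 by (auto simp: b)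
  \<comment> \<open>The coefficients solve
    \<open>\<alpha> * b1 * (p - x) + \<beta> * b2 * (q - x) = 0\<close>.\<close>
  define \<alpha> where "\<alpha> = (x - q) * b2"
  define \<beta> where "\<beta> = - ((x - p) * b1)"
  \<comment> \<open>The brackets with the third interpolant determine the ratio of
    \<open>\<kappa>1\<close> and \<open>\<kappa>2\<close>.\<close>
  have ph: "((r - p) * b1 * cnj ((r - q) * b2)) * \<kappa>1 =
      ((r - q) * b2 * cnj ((r - p) * b1)) * \<kappa>2"
  proof -
    let ?c = "b3 * cnj b3 * \<kappa>3"
    have "?c * (((r - p) * b1 * cnj ((r - q) * b2)) * \<kappa>1) =
        poly (A3 * B1 - A1 * B3) 0 * cnj (poly (A3 * B2 - A2 * B3) 0) * (\<kappa>3 * \<kappa>1)"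
      by (simp add: 1 2 3 b algebra_simps)
    also have "\<dots> = poly (A3 * B2 - A2 * B3) 0 * cnj (poly (A3 * B1 - A1 * B3) 0) * (\<kappa>3 * \<kappa>2)"
      by (rule bracket_phase[OF S 3(1) 1(1) 3(1) 2(1)])
    also have "\<dots> = ?c * (((r - q) * b2 * cnj ((r - p) * b1)) * \<kappa>2)"
      by (simp add: 1 2 3 b algebra_simps)
    finally show ?thesis using k b0 by simp
  qed
  have key: "cnj \<alpha> * \<kappa>1 * \<beta> = cnj \<beta> * \<kappa>2 * \<alpha>"
  proof -
    have re': "(x - p) * (r - q) * cnj ((x - q) * (r - p)) = cnj ((x - p) * (r - q)) * ((x - q) * (r - p))"
      using re by (simp add: real_cross_ratio_def)
    have "(cnj \<alpha> * \<kappa>1 * \<beta>) * ((r - p) * cnj (r - q))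
      = - (x - p) * cnj (x - q) * (((r - p) * b1 * cnj ((r - q) * b2)) * \<kappa>1)"
      by (simp add: \<alpha>_def \<beta>_def algebra_simps)
    also have "\<dots> = - ((x - p) * (r - q) * cnj ((x - q) * (r - p))) * (b2 * cnj b1 * \<kappa>2)"
      unfolding ph by (simp add: algebra_simps)
    also have "\<dots> = - (cnj ((x - p) * (r - q)) * ((x - q) * (r - p))) * (b2 * cnj b1 * \<kappa>2)"
      unfolding re' ..
    also have "\<dots> = (cnj \<beta> * \<kappa>2 * \<alpha>) * ((r - p) * cnj (r - q))"
      by (simp add: \<alpha>_def \<beta>_def)
    finally show ?thesis using dist by (simp del: complex_cnj_diff)
  qed
  have "\<alpha> \<noteq> 0 \<or> \<beta> \<noteq> 0" using dist b0 by (auto simp: \<alpha>_def \<beta>_def)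
  \<comment> \<open>One coefficient vanishes if \<open>x\<close> is \<open>p\<close> or
    \<open>q\<close>, so \<open>\<kappa>\<close> is read off from a nonzero one.\<close>
  then obtain \<kappa> where \<kappa>: "\<kappa> \<noteq> 0" "cnj \<alpha> * \<kappa>1 = \<kappa> * \<alpha>" "cnj \<beta> * \<kappa>2 = \<kappa> * \<beta>"
  proof
    assume a: "\<alpha> \<noteq> 0"
    show ?thesis
      by (rule that[of "cnj \<alpha> * \<kappa>1 / \<alpha>"]) (use a k key in \<open>auto simp: field_simps\<close>)
  next
    assume a: "\<beta> \<noteq> 0"
    show ?thesis
      by (rule that[of "cnj \<beta> * \<kappa>2 / \<beta>"]) (use a k key in \<open>auto simp: field_simps\<close>)
  qed
  let ?A = "smult \<alpha> A1 + smult \<beta> A2" and ?B = "smult \<alpha> B1 + smult \<beta> B2"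
  have "interpolant n S \<kappa> ?A ?B"
    using 1(1) 2(1) \<kappa> unfolding interpolant_def
    by (auto simp: distrib_left mult.left_commute[of _ \<alpha>] mult.left_commute[of _ \<beta>]
      intro!: hermitian_poly_combination)
  moreover have "poly ?B 0 = (p - q) * b1 * b2" "poly ?A 0 = x * poly ?B 0"
    by (simp_all add: 1 2 \<alpha>_def \<beta>_def b algebra_simps)
  ultimately show ?thesis
    unfolding clifford_value_def using dist b0 by (metis mult_eq_0_iff right_minus_eq)
qed

section \<open>Common values of two pencils, and uniqueness\<close>

text \<open>Two members of different pencils with the same value are proportional: by symmetry their
  bracket loses its leading coefficient together with its constant one, which leaves
  more roots than its degree admits.\<close>

lemma clifford_value_meet:
  assumes W: "good_nodes (2 * Suc n) W"
    and a: "good_nodes (Suc (2 * Suc n)) (insert a W)" "clifford_value (Suc n) (insert a W) z"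
    and b: "clifford_value (Suc n) (insert b W) z"
    and z0: "clifford_value n W z\<^sub>0" "z \<noteq> z\<^sub>0"
  shows "clifford_value (Suc n) (insert a (insert b W)) z" "a \<noteq> b \<Longrightarrow> ang a \<noteq> ang b"
proof -
  obtain \<kappa>1 A B where 1: "interpolant (Suc n) (insert a W) \<kappa>1 A B" "poly B 0 \<noteq> 0" "poly A 0 = z * poly B 0"
    using a by (auto simp: clifford_value_def)
  obtain \<kappa>2 A' B' where 2: "interpolant (Suc n) (insert b W) \<kappa>2 A' B'" "poly B' 0 \<noteq> 0" "poly A' 0 = z * poly B' 0"
    using b by (auto simp: clifford_value_def)
  obtain \<kappa>0 A0 B0 where 0: "interpolant n W \<kappa>0 A0 B0" "poly B0 0 \<noteq> 0" "poly A0 0 = z\<^sub>0 * poly B0 0"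
    using z0 by (auto simp: clifford_value_def)
  have W': "finite (ang ` W)" "card (ang ` W) = 2 * Suc n"
    using W by (simp_all add: good_nodes_def card_image)
  have W0: "0 \<notin> ang ` W"
  proof
    assume "0 \<in> ang ` W"
    then obtain \<tau> where "\<tau> \<in> W" "ang \<tau> = 0" by (metis imageE)
    then show False using W ang_nonzero by (metis good_nodes_def)
  qed
  define D where "D = A * B' - A' * B"
  have D: "hermitian_poly (Suc (2 * Suc n)) (\<kappa>1 * \<kappa>2) D"
    unfolding D_def by (rule hermitian_poly_bracket[OF 1(1) 2(1)])
  have D0: "poly D 0 = 0" unfolding D_def by (simp add: 1(3) 2(3))
  have \<kappa>: "\<kappa>1 * \<kappa>2 \<noteq> 0" using 1(1) 2(1) by (simp add: interpolant_def)
  have "coeff D (Suc (2 * Suc n)) = 0"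
    using hermitian_poly_coeffs[OF D] \<kappa> unfolding D0 by (metis complex_cnj_zero mult_eq_0_iff)
  moreover have "degree D \<le> Suc (2 * Suc n)" using D by (simp add: hermitian_poly_def)
  ultimately have "degree D \<le> 2 * Suc n" by (rule degree_le_if_top_coeff_0[rotated])
  moreover have "poly D x = 0" if "x \<in> insert 0 (ang ` W)" for x
    using that D0 interpolant_bracket_root[OF 1(1) 2(1)] by (auto simp: D_def[symmetric])
  ultimately have "D = 0"
    using W' W0 by (intro poly_eq_0_if_many_roots[of D "2 * Suc n" "insert 0 (ang ` W)"]) auto
  then have D': "A * B' = A' * B" by (simp add: D_def)

  \<comment> \<open>\<open>D'\<close> only equates the quotients. To exclude different common
    factors, both pairs are compared with the interpolant for \<open>z\<^sub>0\<close>;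
    \<open>z \<noteq> z\<^sub>0\<close> keeps these brackets nonzero at 0.\<close>
  define E where "E = A * B0 - A0 * B"
  define E' where "E' = A' * B0 - A0 * B'"
  have degE: "degree (F * B0 - A0 * G) \<le> 2 * Suc n" if "interpolant (Suc n) V \<kappa> F G" for F G V \<kappa>
  proof -
    have "degree F \<le> Suc n" "degree G \<le> Suc (Suc n)" "degree A0 \<le> n" "degree B0 \<le> Suc n"
      using that 0(1) by (auto simp: interpolant_def hermitian_poly_def)
    then show ?thesis
      using degree_mult_le[of F B0] degree_mult_le[of A0 G] by (intro degree_diff_le) simp_all
  qed
  have degs: "degree E \<le> 2 * Suc n" "degree E' \<le> 2 * Suc n"
    unfolding E_def E'_def using degE 1(1) 2(1) by blast+
  define e e' where "e = poly E 0" and "e' = poly E' 0"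
  have "e = (z - z\<^sub>0) * poly B 0 * poly B0 0" "e' = (z - z\<^sub>0) * poly B' 0 * poly B0 0"
    by (simp_all add: e_def e'_def E_def E'_def 0 1 2 algebra_simps)
  then have e0: "e \<noteq> 0" "e' \<noteq> 0" using z0 0 1 2 by auto
  then have E0: "E \<noteq> 0" by (auto simp: e_def)
  define p where "p = smult e' E - smult e E'"
  have "degree p \<le> 2 * Suc n"
    unfolding p_def using degs by (intro degree_diff_le order.trans[OF degree_smult_le])
  moreover have "poly p x = 0" if "x \<in> insert 0 (ang ` W)" for x
    using that interpolant_bracket_root[OF 1(1) 0(1)] interpolant_bracket_root[OF 2(1) 0(1)]
    by (auto simp: p_def E_def[symmetric] E'_def[symmetric] e_def e'_def)
  ultimately have "p = 0"
    using W' W0 by (intro poly_eq_0_if_many_roots[of p "2 * Suc n" "insert 0 (ang ` W)"]) auto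
  then have EE: "smult e' E = smult e E'" by (simp add: p_def)
  have "A * E' = A' * E" "B * E' = B' * E"
  proof -
    have "A * E' - A' * E = A0 * (A' * B - A * B')" "B * E' - B' * E = B0 * (A' * B - A * B')"
      by (simp_all add: E_def E'_def algebra_simps)
    then show "A * E' = A' * E" "B * E' = B' * E" using D' by simp_all
  qed
  have "smult e' A * E = A * smult e' E" by simp
  also have "\<dots> = smult e (A * E')" by (simp add: EE)
  also have "\<dots> = smult e A' * E" using \<open>A * E' = A' * E\<close> by simp
  finally have AA: "smult e' A = smult e A'" using E0 by (metis mult_cancel_right)
  have "smult e' B * E = B * smult e' E" by simp
  also have "\<dots> = smult e (B * E')" by (simp add: EE)
  also have "\<dots> = smult e B' * E" using \<open>B * E' = B' * E\<close> by simp
  finally have BB: "smult e' B = smult e B'" using E0 by (metis mult_cancel_right)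
  have int: "\<tau> * poly B (ang \<tau>) = poly A (ang \<tau>)" if "\<tau> \<in> insert b W" for \<tau>
  proof -
    have "e' * (\<tau> * poly B (ang \<tau>)) = \<tau> * poly (smult e' B) (ang \<tau>)" by simp
    also have "\<dots> = e * (\<tau> * poly B' (ang \<tau>))" unfolding BB by simp
    also have "\<dots> = e * poly A' (ang \<tau>)" using that 2(1) by (auto simp: interpolant_def)
    also have "\<dots> = poly (smult e' A) (ang \<tau>)" unfolding AA by simp
    finally show ?thesis using e0 by simp
  qed
  then have "interpolant (Suc n) (insert a (insert b W)) \<kappa>1 A B"
    using 1(1) by (auto simp: interpolant_def)
  then show "clifford_value (Suc n) (insert a (insert b W)) z"
    unfolding clifford_value_def using 1 by blast

  assume "a \<noteq> b"
  show "ang a \<noteq> ang b"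
  proof
    \<comment> \<open>Two conditions at one point force \<open>A\<close> and \<open>B\<close> to
      vanish there, which gives \<open>E\<close> one root too many.\<close>
    assume ab: "ang a = ang b"
    have "a * poly B (ang a) = poly A (ang a)" using 1(1) by (simp add: interpolant_def)
    moreover have "b * poly B (ang a) = poly A (ang a)" using int[of b] ab by simp
    ultimately have "poly B (ang a) = 0"
      using \<open>a \<noteq> b\<close> by (metis mult_cancel_right)
    with \<open>a * poly B (ang a) = poly A (ang a)\<close> have "poly A (ang a) = 0" by simp
    with \<open>poly B (ang a) = 0\<close> have "poly E (ang a) = 0" by (simp add: E_def)
    then have "poly E x = 0" if "x \<in> ang ` insert a W" for x
      using that interpolant_bracket_root[OF 1(1) 0(1)] by (auto simp: E_def[symmetric])
    moreover have "finite (ang ` insert a W)" "card (ang ` insert a W) = Suc (2 * Suc n)"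
      using a(1) by (auto simp: good_nodes_def card_image simp del: image_insert)
    ultimately have "E = 0"
      using degs by (intro poly_eq_0_if_many_roots[of E "2 * Suc n" "ang ` insert a W"]) auto
    then show False using E0 by simp
  qed
qed

text \<open>The bracket of two interpolants has degree at most \<open>2 * n + 1\<close> but vanishes
  at \<open>2 * n + 2\<close> nodes.\<close>

lemma clifford_value_unique:
  assumes S: "good_nodes (2 * Suc n) S" and "clifford_value n S x" "clifford_value n S y"
  shows "x = y"
proof -
  obtain \<kappa>1 A B where 1: "interpolant n S \<kappa>1 A B" "poly B 0 \<noteq> 0" "poly A 0 = x * poly B 0"
    using assms by (auto simp: clifford_value_def)
  obtain \<kappa>2 A' B' where 2: "interpolant n S \<kappa>2 A' B'" "poly B' 0 \<noteq> 0" "poly A' 0 = y * poly B' 0"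
    using assms by (auto simp: clifford_value_def)
  define D where "D = A * B' - A' * B"
  have "degree D \<le> Suc (2 * n)"
    using hermitian_poly_bracket[OF 1(1) 2(1)] by (simp add: D_def hermitian_poly_def)
  moreover have "poly D x = 0" if "x \<in> ang ` S" for x
    using that interpolant_bracket_root[OF 1(1) 2(1)] by (auto simp: D_def[symmetric])
  moreover have "finite (ang ` S)" "card (ang ` S) > Suc (2 * n)"
    using S by (auto simp: good_nodes_def card_image)
  ultimately have "D = 0" by (intro poly_eq_0_if_many_roots[of D "Suc (2 * n)" "ang ` S"]) auto
  then have "poly D 0 = 0" by simp
  then show ?thesis using 1 2 by (simp add: D_def)
qed

section \<open>Circles through the origin\<close>

text \<open>Division of the equation by \<open>c * p * cnj p\<close> turns it into
  \<open>u + ang c * cnj u = 1 / c\<close> with \<open>u = 1 / p\<close>.\<close>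

lemma mem_sphere_iff: "dist c p = norm c \<longleftrightarrow> p * cnj p = cnj c * p + c * cnj p" for c p :: complex
proof -
  have "dist c p = norm c \<longleftrightarrow> (norm (c - p))\<^sup>2 = (norm c)\<^sup>2"
    by (simp add: dist_norm power2_eq_iff_nonneg)
  also have "\<dots> \<longleftrightarrow> complex_of_real ((norm (c - p))\<^sup>2) = complex_of_real ((norm c)\<^sup>2)"
    by (simp only: of_real_eq_iff)
  also have "\<dots> \<longleftrightarrow> (c - p) * cnj (c - p) = c * cnj c"
    by (simp only: complex_norm_square)
  also have "\<dots> \<longleftrightarrow> p * cnj p = cnj c * p + c * cnj p"
    by (auto simp: algebra_simps)
  finally show ?thesis .
qed

text \<open>The interpolant is \<open>A = 1\<close>, \<open>B = u + cnj u * t\<close> with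
  \<open>u = 1 / z\<close>. Equal \<open>ang\<close> would make the two circle equations contradict
  each other: circles touching at 0 do not meet again.\<close>

lemma clifford_value_two_circles:
  assumes "\<tau> \<noteq> \<tau>'" "\<tau> \<noteq> 0" "\<tau>' \<noteq> 0" "z \<noteq> 0"
    and "dist \<tau> z = norm \<tau>" "dist \<tau>' z = norm \<tau>'"
  shows "clifford_value 0 {\<tau>, \<tau>'} z" "ang \<tau> \<noteq> ang \<tau>'"
proof -
  define u where "u = inverse z"
  have u: "\<tau> * (u + cnj u * ang \<tau>) = 1" if "\<tau> \<noteq> 0" "dist \<tau> z = norm \<tau>" for \<tau>
  proof -
    have "\<tau> * (u + cnj u * ang \<tau>) = (cnj \<tau> * z + \<tau> * cnj z) / (z * cnj z)"
      using that(1) assms(4) by (simp add: u_def ang_def field_simps)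
    also have "\<dots> = 1"
      using that(2) assms(4) by (simp add: mem_sphere_iff[THEN iffD1, symmetric])
    finally show ?thesis .
  qed
  have u1: "\<tau> * (u + cnj u * ang \<tau>) = 1" and u2: "\<tau>' * (u + cnj u * ang \<tau>') = 1"
    using u assms by blast+
  have "interpolant 0 {\<tau>, \<tau>'} 1 1 [:u, cnj u:]"
    using u1 u2 assms(4) by (auto simp: interpolant_def hermitian_poly_def algebra_simps u_def)
  then show "clifford_value 0 {\<tau>, \<tau>'} z"
    unfolding clifford_value_def using assms(4)
    by (intro exI[of _ 1] exI[of _ "[:u, cnj u:]"]) (simp add: u_def)
  show "ang \<tau> \<noteq> ang \<tau>'"
  proof
    assume "ang \<tau> = ang \<tau>'"
    then have "\<tau> * (u + cnj u * ang \<tau>) = \<tau>' * (u + cnj u * ang \<tau>)" using u1 u2 by simp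
    then show False using u1 assms(1) by (metis mult_cancel_right mult_zero_right zero_neq_one)
  qed
qed

section \<open>Circles and lines as real cross ratios\<close>

text \<open>Multiplication by \<open>p * q * r\<close> eliminates the conjugates of these points.
  The difference of the two sides then factors, and only the factor \<open>x * cnj x - R\<close> can
  vanish.\<close>

lemma real_cross_ratio_concyclic_iff:
  assumes "p * cnj p = R" "q * cnj q = R" "r * cnj r = R" "R \<noteq> 0" "p \<noteq> q" "p \<noteq> r" "q \<noteq> r"
  shows "real_cross_ratio x p q r \<longleftrightarrow> x * cnj x = R"
proof -
  have "p * q * r * ((x - p) * (r - q) * cnj ((x - q) * (r - p)) - cnj ((x - p) * (r - q)) * ((x - q) * (r - p)))
     = R * (p - r) * (r - q) * (q - p) * (x * cnj x - R)"
  proof -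
    have "p * q * r * ((x - p) * (r - q) * cnj ((x - q) * (r - p)) - cnj ((x - p) * (r - q)) * ((x - q) * (r - p)))
      = (x - p) * (r - q) * (q * (cnj x - cnj q)) * (p * r * (cnj r - cnj p)) -
        (x - q) * (r - p) * (p * (cnj x - cnj p)) * (q * r * (cnj r - cnj q))"
      by (simp add: algebra_simps)
    also have "q * (cnj x - cnj q) = q * cnj x - R"
      using assms(2) by (simp add: right_diff_distrib)
    also have "p * (cnj x - cnj p) = p * cnj x - R"
      using assms(1) by (simp add: right_diff_distrib)
    also have "p * r * (cnj r - cnj p) = R * (p - r)"
    proof -
      have "p * r * (cnj r - cnj p) = p * (r * cnj r) - r * (p * cnj p)" by (simp add: algebra_simps)
      then show ?thesis using assms(1,3) by (simp add: algebra_simps)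
    qed
    also have "q * r * (cnj r - cnj q) = R * (q - r)"
    proof -
      have "q * r * (cnj r - cnj q) = q * (r * cnj r) - r * (q * cnj q)" by (simp add: algebra_simps)
      then show ?thesis using assms(2,3) by (simp add: algebra_simps)
    qed
    finally show ?thesis by (simp add: algebra_simps)
  qed
  moreover have "p * q * r \<noteq> 0" using assms by auto
  ultimately show ?thesis
    using assms unfolding real_cross_ratio_def
    by (metis (no_types, lifting) eq_iff_diff_eq_0 mult_eq_0_iff)
qed

lemma real_cross_ratio_translate:
  "real_cross_ratio (s + x) (s + p) (s + q) (s + r) \<longleftrightarrow> real_cross_ratio x p q r"
  by (simp add: real_cross_ratio_def)

text \<open>The difference of the two sides is a nonzero multiple of
  \<open>\<xi> - cnj \<xi>\<close>.\<close>

lemma real_cross_ratio_collinear_iff: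
  assumes "d \<noteq> 0" "\<alpha> \<noteq> \<beta>" "\<alpha> \<noteq> \<gamma>" "\<beta> \<noteq> \<gamma>"
  shows "real_cross_ratio (a + \<xi> * d) (a + of_real \<alpha> * d) (a + of_real \<beta> * d) (a + of_real \<gamma> * d) \<longleftrightarrow> \<xi> \<in> \<real>"
proof -
  let ?r = "complex_of_real"
  have "(\<xi> * d - ?r \<alpha> * d) * (?r \<gamma> * d - ?r \<beta> * d) * cnj ((\<xi> * d - ?r \<beta> * d) * (?r \<gamma> * d - ?r \<alpha> * d)) -
      cnj ((\<xi> * d - ?r \<alpha> * d) * (?r \<gamma> * d - ?r \<beta> * d)) * ((\<xi> * d - ?r \<beta> * d) * (?r \<gamma> * d - ?r \<alpha> * d))
    = (d * cnj d)\<^sup>2 * (?r \<gamma> - ?r \<beta>) * (?r \<gamma> - ?r \<alpha>) * (?r \<alpha> - ?r \<beta>) * (\<xi> - cnj \<xi>)"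
    by (simp add: algebra_simps power2_eq_square)
  moreover have "(d * cnj d)\<^sup>2 * (?r \<gamma> - ?r \<beta>) * (?r \<gamma> - ?r \<alpha>) * (?r \<alpha> - ?r \<beta>) \<noteq> 0"
    using assms by simp
  ultimately have "real_cross_ratio (\<xi> * d) (?r \<alpha> * d) (?r \<beta> * d) (?r \<gamma> * d) \<longleftrightarrow> \<xi> - cnj \<xi> = 0"
    unfolding real_cross_ratio_def by (metis (no_types, lifting) eq_iff_diff_eq_0 mult_eq_0_iff)
  then show ?thesis
    by (auto simp: real_cross_ratio_translate Reals_cnj_iff)
qed

lemma affine_hull_2_complex: "affine hull {a, b} = {a + of_real u * (b - a) | u. True}" for a b :: complex
proof -
  have "affine hull {a, b} = {u *\<^sub>R a + v *\<^sub>R b | u v. u + v = 1}" by (rule affine_hull_2)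
  also have "\<dots> = {a + of_real u * (b - a) | u. True}" (is "?L = ?R")
  proof (intro set_eqI iffI)
    fix x assume "x \<in> ?L"
    then obtain u v where "x = u *\<^sub>R a + v *\<^sub>R b" "u + v = 1" by blast
    then have "x = (1 - v) *\<^sub>R a + v *\<^sub>R b" by (simp add: eq_diff_eq)
    then have "x = a + of_real v * (b - a)" by (simp add: scaleR_conv_of_real algebra_simps)
    then show "x \<in> ?R" by blast
  next
    fix x assume "x \<in> ?R"
    then obtain v where "x = a + of_real v * (b - a)" by blast
    then have "x = (1 - v) *\<^sub>R a + v *\<^sub>R b" by (simp add: scaleR_conv_of_real algebra_simps)
    moreover have "(1 - v) + v = 1" by simp
    ultimately show "x \<in> ?L" by blast
  qed
  finally show ?thesis .
qed

lemma circle_mem_iff: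
  assumes C: "circle_with_center c C"
    and "Fin p \<in> C" "Fin q \<in> C" "Fin r \<in> C" "p \<noteq> q" "p \<noteq> r" "q \<noteq> r"
  shows "Fin x \<in> C \<longleftrightarrow> real_cross_ratio x p q r"
proof (cases c)
  case (Fin e)
  then obtain \<rho> where \<rho>: "\<rho> > 0" "C = Fin ` sphere e \<rho>" using C by auto
  have mem: "Fin y \<in> C \<longleftrightarrow> (- e + y) * cnj (- e + y) = of_real (\<rho>\<^sup>2)" for y
  proof -
    have "Fin y \<in> C \<longleftrightarrow> norm (- e + y) = \<rho>"
      by (auto simp: \<rho> dist_norm norm_minus_commute)
    also have "\<dots> \<longleftrightarrow> (norm (- e + y))\<^sup>2 = \<rho>\<^sup>2" using \<rho> by (simp add: power2_eq_iff_nonneg)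
    also have "\<dots> \<longleftrightarrow> complex_of_real ((norm (- e + y))\<^sup>2) = of_real (\<rho>\<^sup>2)" by (simp only: of_real_eq_iff)
    finally show ?thesis by (simp only: complex_norm_square)
  qed
  have "real_cross_ratio (- e + x) (- e + p) (- e + q) (- e + r) \<longleftrightarrow> (- e + x) * cnj (- e + x) = of_real (\<rho>\<^sup>2)"
    using assms mem \<rho> by (intro real_cross_ratio_concyclic_iff) auto
  then show ?thesis by (simp only: real_cross_ratio_translate mem)
next
  case Infty
  then obtain a b where ab: "a \<noteq> b" "C = insert Infty (Fin ` (affine hull {a, b}))" using C by auto
  have mem: "Fin y \<in> C \<longleftrightarrow> (\<exists>u. y = a + of_real u * (b - a))" for y
    by (auto simp: ab affine_hull_2_complex)
  obtain \<alpha> \<beta> \<gamma> where e: "p = a + of_real \<alpha> * (b - a)" "q = a + of_real \<beta> * (b - a)" "r = a + of_real \<gamma> * (b - a)"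
    using assms mem by blast
  define \<xi> where "\<xi> = (x - a) / (b - a)"
  have \<xi>: "x = a + \<xi> * (b - a)" using ab by (simp add: \<xi>_def)
  have "Fin x \<in> C \<longleftrightarrow> \<xi> \<in> \<real>"
    using ab unfolding mem by (auto simp: \<xi> Reals_def)
  also have "\<dots> \<longleftrightarrow> real_cross_ratio x p q r"
    unfolding \<xi> e by (rule real_cross_ratio_collinear_iff[symmetric]) (use assms e ab in auto)
  finally show ?thesis .
qed

text \<open>Both sides say that the cross ratio with the three known points is real. This is the
  bridge from circles to pencils of interpolants.\<close>

lemma circle_mem_iff_clifford_value:
  assumes S: "good_nodes (Suc (2 * n)) S"
    and "clifford_value n S p" "clifford_value n S q" "clifford_value n S r"
    and "p \<noteq> q" "p \<noteq> r" "q \<noteq> r"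
    and "circle_with_center c C" "Fin (s + p) \<in> C" "Fin (s + q) \<in> C" "Fin (s + r) \<in> C"
  shows "Fin (s + x) \<in> C \<longleftrightarrow> clifford_value n S x"
proof -
  have "Fin (s + x) \<in> C \<longleftrightarrow> real_cross_ratio (s + x) (s + p) (s + q) (s + r)"
    using assms by (intro circle_mem_iff) auto
  also have "\<dots> \<longleftrightarrow> clifford_value n S x"
    unfolding real_cross_ratio_translate
    using assms real_cross_ratio_clifford_value clifford_value_if_real_cross_ratio by metis
  finally show ?thesis .
qed

section \<open>Nondegeneracy from unique existence\<close>

lemma circle_with_center_Fin_unique:
  assumes "circle_with_center (Fin c) A" "circle_with_center (Fin c) B" "x \<in> A" "x \<in> B"
  shows "A = B"
  using assms by auto

lemma sphere_through: "p \<noteq> c \<Longrightarrow> circle_with_center (Fin c) (Fin ` sphere c (dist c p))"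
  by (auto intro!: exI[of _ "dist c p"])

lemma sphere_third_point:
  fixes c p q :: complex
  assumes "r > 0"
  obtains y where "y \<in> sphere c r" "y \<noteq> p" "y \<noteq> q"
proof -
  let ?S = "{c + of_real r, c - of_real r, c + \<i> * of_real r}"
  have "c + of_real r \<noteq> c - of_real r" "c + of_real r \<noteq> c + \<i> * of_real r" "c - of_real r \<noteq> c + \<i> * of_real r"
    using assms by (auto simp: complex_eq_iff)
  then have "card ?S = 3" by simp
  moreover have "card {p, q} \<le> 2" by (simp add: card_insert_if)
  ultimately have "\<not> ?S \<subseteq> {p, q}" using card_mono[of "{p, q}" ?S] by auto
  then obtain y where "y \<in> ?S" "y \<noteq> p" "y \<noteq> q" by blast
  moreover have "?S \<subseteq> sphere c r" using assms by (auto simp: dist_norm norm_mult)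
  ultimately show ?thesis using that by blast
qed

lemma line_through:
  assumes "p \<noteq> q"
  shows "\<exists>L. circle_with_center Infty L \<and> Fin p \<in> L \<and> Fin q \<in> L \<and> Infty \<in> L"
  by (rule exI[of _ "insert Infty (Fin ` (affine hull {p, q}))"])
    (use assms in \<open>auto simp: hull_inc\<close>)

lemma other_intersection_commute: "other_intersection a b p x \<longleftrightarrow> other_intersection b a p x"
  unfolding other_intersection_def by blast

text \<open>The center infinity leaves the line through \<open>p\<close> free: it can be turned to
  meet the other circle in another point.\<close>

lemma not_unique_other_intersection_Infty:
  "\<not> (\<exists>!x. other_intersection Infty b p x)"
proof
  assume ex1: "\<exists>!x. other_intersection Infty b p x"
  then obtain x where x: "other_intersection Infty b p x" by blast
  have "\<exists>y. y \<noteq> x \<and> other_intersection Infty b p y"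
  proof (cases b)
    case (Fin c)
    obtain B where B: "circle_with_center b B" "p \<in> B" "x \<in> B" "x \<noteq> p"
      using x by (auto simp: other_intersection_def)
    obtain r where r: "r > 0" "B = Fin ` sphere c r" using B Fin by auto
    obtain p' x' where px: "p = Fin p'" "x = Fin x'" using B r by auto
    obtain y where y: "y \<in> sphere c r" "y \<noteq> p'" "y \<noteq> x'" using sphere_third_point[OF r(1)] .
    obtain L where "circle_with_center Infty L" "Fin p' \<in> L" "Fin y \<in> L"
      using line_through[of p' y] y by blast
    then have "other_intersection Infty b p (Fin y)"
      using B r y px unfolding other_intersection_def by blast
    then show ?thesis using y px by blast
  next
    case Infty
    have line: "other_intersection Infty b (Fin p') (Fin y)" if ne: "p' \<noteq> y" for p' y
    proof -
      obtain L where "circle_with_center Infty L" "Fin p' \<in> L" "Fin y \<in> L"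
        using line_through[OF ne] by blast
      then show ?thesis using ne Infty unfolding other_intersection_def by auto
    qed
    have line': "other_intersection Infty b Infty (Fin y)" for y
    proof -
      have "y \<noteq> y + 1" by simp
      then obtain L where "circle_with_center Infty L" "Infty \<in> L" "Fin y \<in> L"
        using line_through[of y "y + 1"] by blast
      then show ?thesis using Infty unfolding other_intersection_def by auto
    qed
    show ?thesis
    proof (cases p)
      case (Fin p')
      have "other_intersection Infty b p (Fin (p' + 1))" "other_intersection Infty b p (Fin (p' + 2))"
        using line Fin by auto
      moreover have "Fin (p' + 1) \<noteq> Fin (p' + 2)" by simp
      ultimately show ?thesis by metis
    next
      case Infty
      have "other_intersection Infty b p (Fin 0)" "other_intersection Infty b p (Fin 1)"
        using line' Infty by auto
      moreover have "Fin 0 \<noteq> Fin 1" by simp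
      ultimately show ?thesis by metis
    qed
  qed
  then show False using ex1 x by blast
qed

text \<open>Equal finite centers give one and the same circle through \<open>p\<close>, and each of
  its other points is a candidate.\<close>

lemma unique_other_intersection_centers:
  assumes ex1: "\<exists>!x. other_intersection a b p x"
  obtains a' b' where "a = Fin a'" "b = Fin b'" "a' \<noteq> b'"
proof -
  obtain a' where a: "a = Fin a'"
    using ex1 not_unique_other_intersection_Infty by (cases a) auto
  have "\<exists>!x. other_intersection b a p x" using ex1 by (subst other_intersection_commute)
  then obtain b' where b: "b = Fin b'"
    using not_unique_other_intersection_Infty by (cases b) auto
  have "a' \<noteq> b'"
  proof
    assume "a' = b'"
    obtain x where x: "other_intersection a b p x" using ex1 by blast
    then obtain A where A: "circle_with_center a A" "p \<in> A" "x \<in> A" "x \<noteq> p"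
      by (auto simp: other_intersection_def)
    obtain r where r: "r > 0" "A = Fin ` sphere a' r" using A a by auto
    obtain p' x' where px: "p = Fin p'" "x = Fin x'" using A r by auto
    obtain y where y: "y \<in> sphere a' r" "y \<noteq> p'" "y \<noteq> x'" using sphere_third_point[OF r(1)] .
    then have "other_intersection a b p (Fin y)"
      using A a b \<open>a' = b'\<close> r px unfolding other_intersection_def by blast
    then show False using ex1 x px y by blast
  qed
  then show ?thesis using that a b by blast
qed

lemma two_equidistant_centers:
  fixes p q :: complex
  obtains c c' where "c \<noteq> c'" "c \<noteq> p" "dist c q = dist c p" "c' \<noteq> p" "dist c' q = dist c' p"
proof (cases "p = q")
  case True
  show ?thesis by (rule that[of "p + 1" "p + 2"]) (use True in auto)
next
  case False
  \<comment> \<open>These points form the perpendicular bisector of \<open>p\<close> and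
    \<open>q\<close>; \<open>u = 0\<close> is the midpoint.\<close>
  define c where "c u = p + Complex (1 / 2) u * (q - p)" for u
  have "dist (c u) q = dist (c u) p" for u
  proof -
    have "c u - p = Complex (1 / 2) u * (q - p)" "c u - q = Complex (- 1 / 2) u * (q - p)"
      by (auto simp: c_def complex_eq_iff algebra_simps)
    moreover have "norm (Complex (1 / 2) u) = norm (Complex (- 1 / 2) u)" by (simp add: cmod_def)
    ultimately show ?thesis by (simp add: dist_norm norm_mult)
  qed
  moreover have "c u \<noteq> p" for u
  proof -
    have "Complex (1 / 2) u \<noteq> 0" by (simp add: complex_eq_iff)
    then show ?thesis using False by (simp add: c_def)
  qed
  moreover have "c 0 \<noteq> c 1" using False by (auto simp: c_def)
  ultimately show ?thesis using that by blast
qed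

text \<open>If two of the points coincide, at most two points remain, and circles with different
  centers pass through them.\<close>

lemma unique_center_distinct:
  assumes ex1: "\<exists>!c. center_of_circle_through (Fin p) (Fin q) (Fin r) c"
  shows "p \<noteq> q" "p \<noteq> r" "q \<noteq> r"
proof -
  have *: "\<not> {p, q, r} \<subseteq> {x, y}" for x y
  proof
    assume sub: "{p, q, r} \<subseteq> {x, y}"
    obtain c c' where c: "c \<noteq> c'" "c \<noteq> x" "dist c y = dist c x" "c' \<noteq> x" "dist c' y = dist c' x"
      using two_equidistant_centers .
    have "center_of_circle_through (Fin p) (Fin q) (Fin r) (Fin b)"
      if "b \<noteq> x" "dist b y = dist b x" for b
      unfolding center_of_circle_through_def
    proof (intro exI conjI)
      show "circle_with_center (Fin b) (Fin ` sphere b (dist b x))"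
        using that by (intro sphere_through) simp
      have "{x, y} \<subseteq> sphere b (dist b x)" using that by simp
      then have "Fin ` {p, q, r} \<subseteq> Fin ` sphere b (dist b x)" using sub by blast
      then show "{Fin p, Fin q, Fin r} \<subseteq> Fin ` sphere b (dist b x)" by simp
    qed
    then show False using ex1 c by blast
  qed
  show "p \<noteq> q" "p \<noteq> r" "q \<noteq> r" using *[of p r] *[of p q] by auto
qed

section \<open>Windows of consecutive nodes\<close>

text \<open>For even \<open>i - j\<close> the window consists of the \<open>j\<close> nodes with odd index nearest to \<open>i\<close>.\<close>

definition window :: "(int \<Rightarrow> complex) \<Rightarrow> int \<Rightarrow> nat \<Rightarrow> complex set" where
  "window \<tau> i j = (\<lambda>k. \<tau> (i - int j + 1 + 2 * int k)) ` {..<j}"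

text \<open>\<open>\<sigma>\<close> belongs to the singular circle. Adding it for odd
  \<open>j\<close> makes the count even, of the form \<open>2 * n + 2\<close> that determines a
  single Clifford point.\<close>

definition point_nodes :: "(int \<Rightarrow> complex) \<Rightarrow> complex \<Rightarrow> int \<Rightarrow> nat \<Rightarrow> complex set" where
  "point_nodes \<tau> \<sigma> i j = (if odd j then insert \<sigma> (window \<tau> i j) else window \<tau> i j)"

text \<open>The opposite parity gives an odd count \<open>2 * n + 1\<close>, that of a
  pencil.\<close>

definition circle_nodes :: "(int \<Rightarrow> complex) \<Rightarrow> complex \<Rightarrow> int \<Rightarrow> nat \<Rightarrow> complex set" where
  "circle_nodes \<tau> \<sigma> i j = (if even j then insert \<sigma> (window \<tau> i j) else window \<tau> i j)"

lemma window_Suc_left: "window \<tau> i (Suc j) = insert (\<tau> (i - int j)) (window \<tau> (i + 1) j)"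
  unfolding window_def lessThan_Suc_eq_insert_0 by (simp add: image_image algebra_simps)

lemma window_Suc_right: "window \<tau> i (Suc j) = insert (\<tau> (i + int j)) (window \<tau> (i - 1) j)"
  unfolding window_def lessThan_Suc by (simp add: algebra_simps)

lemma window_Suc_Suc:
  "window \<tau> i (Suc (Suc j)) = insert (\<tau> (i - 1 - int j)) (insert (\<tau> (i + 1 + int j)) (window \<tau> i j))"
  by (simp add: window_Suc_left[of \<tau> i "Suc j"] window_Suc_right[of \<tau> "i + 1" j] diff_diff_eq)

text \<open>A shift by 2 replaces the first node by the one following the last, which lies a full
  period \<open>2 * m\<close> further on.\<close>

lemma window_shift:
  assumes per: "\<And>k. \<tau> (k + 2 * int m) = \<tau> k"
  shows "window \<tau> (i + 2 * l) m = window \<tau> i m"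
proof -
  have step: "window \<tau> (i + 2) m = window \<tau> i m" for i
  proof (cases m)
    case (Suc j)
    have "\<tau> (i + 2 + int j) = \<tau> (i - int j)"
      using per[of "i - int j"] Suc by (simp add: algebra_simps)
    moreover have "i + 2 - 1 = i + 1" by simp
    ultimately show ?thesis
      unfolding Suc by (metis window_Suc_left window_Suc_right)
  qed (simp add: window_def)
  show ?thesis
  proof (induction l rule: int_induct[of _ 0])
    case (step1 l)
    then show ?case using step[of "i + 2 * l"] by (simp add: algebra_simps)
  next
    case (step2 l)
    then show ?case using step[of "i + 2 * (l - 1)"] by (simp add: algebra_simps)
  qed simp
qed

lemma card_window_le: "card (window \<tau> i j) \<le> j"
  unfolding window_def using card_image_le[of "{..<j}"] by simp

lemma finite_window: "finite (window \<tau> i j)"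
  by (simp add: window_def)

text \<open>The bound on \<open>card W\<close> forces \<open>a\<close> to lie outside
  \<open>W\<close>.\<close>

lemma good_nodes_of_insert:
  assumes "good_nodes (Suc k) (insert a W)" "card W \<le> k"
  shows "good_nodes k W"
  using assms by (auto simp: good_nodes_def card_insert_if inj_on_insert split: if_splits)

lemma good_nodes_insert_insert:
  assumes "good_nodes (Suc k) (insert a V)" "good_nodes (Suc k) (insert b V)" "card V \<le> k" "ang a \<noteq> ang b"
  shows "good_nodes (Suc (Suc k)) (insert a (insert b V))"
proof -
  have V: "good_nodes k V" using assms(1,3) by (rule good_nodes_of_insert)
  have "a \<notin> V" "b \<notin> V" using assms(1,2) V by (auto simp: good_nodes_def card_insert_if)
  then show ?thesis
    using assms V by (auto simp: good_nodes_def card_insert_if)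
qed

section \<open>The invariant: rows of Clifford points and circles\<close>

text \<open>\<open>p\<close> and \<open>q\<close> are the intersection points of the rows
  \<open>j\<close> and \<open>j + 1\<close>, and \<open>d\<close> holds the centers of row
  \<open>j + 1\<close>. The shift by \<open>s\<close> moves the singular point to the origin.
  Goodness is asked of the window together with \<open>\<sigma>\<close>, which contains the nodes of
  points and of circles for either parity.\<close>

definition clifford_rows ::
  "complex \<Rightarrow> (int \<Rightarrow> complex) \<Rightarrow> complex \<Rightarrow> nat \<Rightarrow> row \<Rightarrow> row \<Rightarrow> row \<Rightarrow> bool" where
  "clifford_rows s \<tau> \<sigma> j p q d \<longleftrightarrow>
     (\<forall>i. row_index j i \<longrightarrow>
        (\<exists>\<zeta>. p i = Fin (s + \<zeta>) \<and> clifford_value ((j - 1) div 2) (point_nodes \<tau> \<sigma> i j) \<zeta>)) \<and>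
     (\<forall>i. row_index (Suc j) i \<longrightarrow>
        (\<exists>\<zeta>. q i = Fin (s + \<zeta>) \<and> clifford_value (j div 2) (point_nodes \<tau> \<sigma> i (Suc j)) \<zeta>) \<and>
        good_nodes (Suc (Suc j)) (insert \<sigma> (window \<tau> i (Suc j))) \<and>
        (\<exists>!c. center_of_circle_through (p (i - 1)) (p (i + 1)) (q i) c) \<and>
        center_of_circle_through (p (i - 1)) (p (i + 1)) (q i) (d i))"

text \<open>The three defining points are values of one pencil: those of \<open>p\<close> gain a
  node at one end of the window, while that of \<open>q\<close> gains or loses
  \<open>\<sigma>\<close> according to parity. Unique existence of the center makes them distinct,
  so they determine the circle.\<close>

lemma clifford_rows_circle:
  assumes inv: "clifford_rows s \<tau> \<sigma> j p q d" and j: "j \<ge> 1" and i: "row_index (Suc j) i"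
  defines "n \<equiv> Suc ((j - 1) div 2)"
  shows "good_nodes (Suc (2 * n)) (circle_nodes \<tau> \<sigma> i (Suc j))"
    and "\<exists>K. circle_with_center (d i) K \<and> {p (i - 1), p (i + 1), q i} \<subseteq> K \<and>
      (\<forall>\<zeta>. Fin (s + \<zeta>) \<in> K \<longleftrightarrow> clifford_value n (circle_nodes \<tau> \<sigma> i (Suc j)) \<zeta>)"
proof -
  let ?X = "circle_nodes \<tau> \<sigma> i (Suc j)" and ?n = "(j - 1) div 2"
  have i': "row_index j (i - 1)" "row_index j (i + 1)" using i by (auto simp: row_index_def)
  obtain \<zeta>1 where 1: "p (i - 1) = Fin (s + \<zeta>1)" "clifford_value ?n (point_nodes \<tau> \<sigma> (i - 1) j) \<zeta>1"
    using inv i' unfolding clifford_rows_def by blast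
  obtain \<zeta>2 where 2: "p (i + 1) = Fin (s + \<zeta>2)" "clifford_value ?n (point_nodes \<tau> \<sigma> (i + 1) j) \<zeta>2"
    using inv i' unfolding clifford_rows_def by blast
  obtain \<zeta>3 where 3: "q i = Fin (s + \<zeta>3)" "clifford_value (j div 2) (point_nodes \<tau> \<sigma> i (Suc j)) \<zeta>3"
    using inv i unfolding clifford_rows_def by blast
  have good: "good_nodes (Suc (Suc j)) (insert \<sigma> (window \<tau> i (Suc j)))"
    and ex1: "\<exists>!c. center_of_circle_through (p (i - 1)) (p (i + 1)) (q i) c"
    and cen: "center_of_circle_through (p (i - 1)) (p (i + 1)) (q i) (d i)"
    using inv i unfolding clifford_rows_def by blast+
  have dist: "\<zeta>1 \<noteq> \<zeta>2" "\<zeta>1 \<noteq> \<zeta>3" "\<zeta>2 \<noteq> \<zeta>3"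
    using unique_center_distinct[OF ex1[unfolded 1 2 3]] by auto
  have 0: "0 \<notin> insert \<sigma> (window \<tau> i (Suc j))" using good by (simp add: good_nodes_def)
  have left: "?X = insert (\<tau> (i + int j)) (point_nodes \<tau> \<sigma> (i - 1) j)"
    by (auto simp: circle_nodes_def point_nodes_def window_Suc_right)
  have right: "?X = insert (\<tau> (i - int j)) (point_nodes \<tau> \<sigma> (i + 1) j)"
    by (auto simp: circle_nodes_def point_nodes_def window_Suc_left)
  have "\<tau> (i + int j) \<noteq> 0" using 0 by (auto simp: window_Suc_right)
  then have v1: "clifford_value n ?X \<zeta>1"
    unfolding n_def left by (intro clifford_value_insert 1)
  have "\<tau> (i - int j) \<noteq> 0" using 0 by (auto simp: window_Suc_left)
  then have v2: "clifford_value n ?X \<zeta>2"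
    unfolding n_def right by (intro clifford_value_insert 2)
  have v3: "clifford_value n ?X \<zeta>3"
  proof (cases "odd j")
    case True
    then have "j div 2 = (j - 1) div 2" by (auto elim: oddE)
    moreover have "?X = insert \<sigma> (point_nodes \<tau> \<sigma> i (Suc j))"
      using True by (simp add: circle_nodes_def point_nodes_def)
    ultimately show ?thesis
      unfolding n_def using clifford_value_insert[OF 3(2), of \<sigma>] 0 by auto
  next
    case False
    then have "j div 2 = n" using j by (auto simp: n_def elim!: evenE)
    moreover have "?X \<subseteq> point_nodes \<tau> \<sigma> i (Suc j)"
      using False by (auto simp: circle_nodes_def point_nodes_def)
    ultimately show ?thesis using clifford_value_mono[OF 3(2)] by simp
  qed
  show goodX: "good_nodes (Suc (2 * n)) ?X"
  proof (cases "odd j")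
    case True
    then have "Suc (2 * n) = Suc (Suc j)" by (auto simp: n_def elim: oddE)
    then show ?thesis using good True by (simp add: circle_nodes_def)
  next
    case False
    then have "Suc (2 * n) = Suc j" using j by (auto simp: n_def elim!: evenE)
    then show ?thesis
      using good_nodes_of_insert[OF good card_window_le] False by (simp add: circle_nodes_def)
  qed
  obtain K where K: "circle_with_center (d i) K" "{p (i - 1), p (i + 1), q i} \<subseteq> K"
    using cen by (auto simp: center_of_circle_through_def)
  have "Fin (s + \<zeta>) \<in> K \<longleftrightarrow> clifford_value n ?X \<zeta>" for \<zeta>
    using K 1 2 3 by (intro circle_mem_iff_clifford_value[OF goodX v1 v2 v3 dist K(1)]) auto
  then show "\<exists>K. circle_with_center (d i) K \<and> {p (i - 1), p (i + 1), q i} \<subseteq> K \<and>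
      (\<forall>\<zeta>. Fin (s + \<zeta>) \<in> K \<longleftrightarrow> clifford_value n ?X \<zeta>)"
    using K by blast
qed

lemma step_defined_new:
  assumes "step_defined j p c q" "row_index j i"
  shows "\<exists>!x. other_intersection (c (i - 1)) (c (i + 1)) (p i) x"
    "other_intersection (c (i - 1)) (c (i + 1)) (p i) (new_points p c i)"
    "\<exists>!x. center_of_circle_through (q (i - 1)) (q (i + 1)) (new_points p c i) x"
    "center_of_circle_through (q (i - 1)) (q (i + 1)) (new_points p c i)
       (new_centers q (new_points p c) i)"
proof -
  show 1: "\<exists>!x. other_intersection (c (i - 1)) (c (i + 1)) (p i) x"
    and 2: "\<exists>!x. center_of_circle_through (q (i - 1)) (q (i + 1)) (new_points p c i) x"
    using assms unfolding step_defined_def by blast+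
  show "other_intersection (c (i - 1)) (c (i + 1)) (p i) (new_points p c i)"
    unfolding new_points_def by (rule theI'[OF 1])
  show "center_of_circle_through (q (i - 1)) (q (i + 1)) (new_points p c i)
      (new_centers q (new_points p c) i)"
    unfolding new_centers_def by (rule theI'[OF 2])
qed

text \<open>Inductive step of Clifford's chain. The two circles belong to pencils whose nodes extend
  \<open>?W\<close> by \<open>a\<close> and by \<open>b\<close>. They share the old point, a
  Clifford value for \<open>?W\<close>; their other common point is a value for all the nodes by
  \<open>clifford_value_meet\<close>.\<close>

lemma clifford_rows_step:
  assumes inv: "clifford_rows s \<tau> \<sigma> j p q d" and j: "j \<ge> 1" and step: "step_defined j p d q"
  shows "clifford_rows s \<tau> \<sigma> (Suc j) q (new_points p d) (new_centers q (new_points p d))"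
proof -
  define p' where "p' = new_points p d"
  have "(\<exists>\<zeta>. p' i = Fin (s + \<zeta>) \<and> clifford_value (Suc j div 2) (point_nodes \<tau> \<sigma> i (Suc (Suc j))) \<zeta>) \<and>
    good_nodes (Suc (Suc (Suc j))) (insert \<sigma> (window \<tau> i (Suc (Suc j))))"
    if "row_index (Suc (Suc j)) i" for i
  proof -
    have i: "row_index j i" "row_index (Suc j) (i - 1)" "row_index (Suc j) (i + 1)"
      using that by (auto simp: row_index_def)
    define n where "n = Suc ((j - 1) div 2)"
    define a b where "a = \<tau> (i - 1 - int j)" and "b = \<tau> (i + 1 + int j)"
    let ?W = "point_nodes \<tau> \<sigma> i j" and ?V = "insert \<sigma> (window \<tau> i j)"
    let ?X = "circle_nodes \<tau> \<sigma> (i - 1) (Suc j)" and ?Y = "circle_nodes \<tau> \<sigma> (i + 1) (Suc j)"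
    have X: "?X = insert a ?W" and Y: "?Y = insert b ?W"
      by (auto simp: circle_nodes_def point_nodes_def a_def b_def window_Suc_left[of _ "i - 1"]
        window_Suc_right[of _ "i + 1"])
    obtain a' b' where ab': "d (i - 1) = Fin a'" "d (i + 1) = Fin b'" "a' \<noteq> b'"
      using unique_other_intersection_centers[OF step_defined_new(1)[OF step i(1)]] .
    have idx: "i - 1 + 1 = i" "i + 1 - 1 = i" "i + 1 + 1 = i + 2" by simp_all
    obtain K where K: "circle_with_center (Fin a') K" "p i \<in> K"
      "\<And>\<zeta>. Fin (s + \<zeta>) \<in> K \<longleftrightarrow> clifford_value n ?X \<zeta>"
      using clifford_rows_circle(2)[OF inv j i(2)] unfolding ab' idx n_def[symmetric] by blast
    obtain L where L: "circle_with_center (Fin b') L" "p i \<in> L" "p (i + 2) \<in> L" "q (i + 1) \<in> L"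
      "\<And>\<zeta>. Fin (s + \<zeta>) \<in> L \<longleftrightarrow> clifford_value n ?Y \<zeta>"
      using clifford_rows_circle(2)[OF inv j i(3)] unfolding ab' idx n_def[symmetric] by blast
    have goodX: "good_nodes (Suc (2 * n)) ?X"
      unfolding n_def by (rule clifford_rows_circle(1)[OF inv j i(2)])
    obtain A B where AB: "circle_with_center (Fin a') A" "circle_with_center (Fin b') B"
      "p i \<in> A" "p i \<in> B" "p' i \<in> A" "p' i \<in> B" "p' i \<noteq> p i"
      using step_defined_new(2)[OF step i(1)] unfolding other_intersection_def ab' p'_def by blast
    \<comment> \<open>A finite center and one point determine a circle, so the intersected circles
      are the Clifford circles.\<close>
    have "A = K" "B = L" using circle_with_center_Fin_unique AB K L by blast+
    obtain x where "p' i = Fin x" using AB(1,5) by auto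
    then obtain \<zeta> where \<zeta>: "p' i = Fin (s + \<zeta>)" by (metis add_diff_cancel_left' diff_add_cancel add.commute)
    obtain \<zeta>0 where \<zeta>0: "p i = Fin (s + \<zeta>0)" "clifford_value ((j - 1) div 2) ?W \<zeta>0"
      using inv i(1) unfolding clifford_rows_def by blast
    have "\<zeta> \<noteq> \<zeta>0" using AB \<zeta> \<zeta>0 by auto
    have vX: "clifford_value n (insert a ?W) \<zeta>" and vY: "clifford_value n (insert b ?W) \<zeta>"
      using AB \<zeta> K(3) L(5) \<open>A = K\<close> \<open>B = L\<close> unfolding X Y by auto
    \<comment> \<open>Otherwise both circles have the same finite points, and three points would
      admit two centers.\<close>
    have "a \<noteq> b"
    proof
      assume "a = b"
      then have "?X = ?Y" using X Y by simp
      then have KL: "Fin (s + \<zeta>) \<in> K \<longleftrightarrow> Fin (s + \<zeta>) \<in> L" for \<zeta> using K(3) L(5) by simp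
      have fin: "x \<in> L \<Longrightarrow> x \<in> K" for x
      proof -
        assume x: "x \<in> L"
        then obtain y where "x = Fin y" using L(1) by auto
        then have "x = Fin (s + (y - s))" by simp
        then show "x \<in> K" using KL[of "y - s"] x by metis
      qed
      have "center_of_circle_through (p i) (p (i + 2)) (q (i + 1)) (Fin a')"
        using K(1) fin L unfolding center_of_circle_through_def by blast
      moreover have "center_of_circle_through (p i) (p (i + 2)) (q (i + 1)) (Fin b')"
        using L unfolding center_of_circle_through_def by blast
      moreover have "\<exists>!c. center_of_circle_through (p (i + 1 - 1)) (p (i + 1 + 1)) (q (i + 1)) c"
        using inv i(3) unfolding clifford_rows_def by blast
      then have "\<exists>!c. center_of_circle_through (p i) (p (i + 2)) (q (i + 1)) c"
        by (simp add: add.assoc)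
      ultimately show False using ab'(3) by blast
    qed
    have "card ?W \<le> (if odd j then Suc j else j)"
      using card_window_le[of \<tau> i j] by (simp add: point_nodes_def card_insert_if finite_window)
    also have "\<dots> = 2 * n" using j by (auto simp: n_def elim!: evenE oddE)
    finally have goodW: "good_nodes (2 * n) ?W" using good_nodes_of_insert goodX unfolding X by blast
    have meet: "clifford_value n (insert a (insert b ?W)) \<zeta>" "ang a \<noteq> ang b"
      using clifford_value_meet[of "(j - 1) div 2" ?W a \<zeta> b \<zeta>0] goodW goodX vX vY \<zeta>0(2) \<open>\<zeta> \<noteq> \<zeta>0\<close> \<open>a \<noteq> b\<close>
      unfolding X n_def by blast+
    have "point_nodes \<tau> \<sigma> i (Suc (Suc j)) = insert a (insert b ?W)"
      by (auto simp: point_nodes_def a_def b_def window_Suc_Suc)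
    moreover have "n = Suc j div 2" using j by (auto simp: n_def elim!: evenE oddE)
    ultimately have "clifford_value (Suc j div 2) (point_nodes \<tau> \<sigma> i (Suc (Suc j))) \<zeta>" using meet by simp
    moreover have "good_nodes (Suc (Suc (Suc j))) (insert \<sigma> (window \<tau> i (Suc (Suc j))))"
    proof -
      have "good_nodes (Suc (Suc j)) (insert \<sigma> (window \<tau> (i - 1) (Suc j)))"
        "good_nodes (Suc (Suc j)) (insert \<sigma> (window \<tau> (i + 1) (Suc j)))"
        using inv i unfolding clifford_rows_def by blast+
      moreover have "insert \<sigma> (window \<tau> (i - 1) (Suc j)) = insert a ?V"
        "insert \<sigma> (window \<tau> (i + 1) (Suc j)) = insert b ?V"
        by (auto simp: a_def b_def window_Suc_left[of _ "i - 1"] window_Suc_right[of _ "i + 1"])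
      moreover have "card ?V \<le> Suc j"
        using card_window_le[of \<tau> i j] by (simp add: card_insert_if finite_window)
      moreover have "insert \<sigma> (window \<tau> i (Suc (Suc j))) = insert a (insert b ?V)"
        by (auto simp: a_def b_def window_Suc_Suc)
      ultimately show ?thesis using good_nodes_insert_insert meet(2) by simp
    qed
    ultimately show ?thesis using \<zeta> by blast
  qed
  then show ?thesis
    using inv step_defined_new(3,4)[OF step]
    unfolding clifford_rows_def p'_def[symmetric] by (simp add: row_index_def)
qed

text \<open>By periodicity all indices of row \<open>j + 1\<close> have the same nodes. Hence the
  points agree by uniqueness of the Clifford value, and the circles agree in their finite
  points.\<close>

lemma clifford_rows_singular:
  assumes rows: "clifford_rows s \<tau> \<sigma> j p q d" and j: "j \<ge> 1"
    and per: "\<And>k. \<tau> (k + 2 * int (Suc j)) = \<tau> k"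
  shows "\<exists>a b. constant_row (Suc j) q a \<and> constant_row (Suc j) d b"
proof -
  have "q i = q k \<and> d i = d k" if i: "row_index (Suc j) i" and k: "row_index (Suc j) k" for i k
  proof -
    have "even (k - i)" using i k by (auto simp: row_index_def)
    then obtain l where "k = i + 2 * l" by (metis add_diff_cancel_left' diff_add_cancel dvdE add.commute)
    then have win: "window \<tau> k (Suc j) = window \<tau> i (Suc j)" using window_shift[of \<tau> "Suc j", OF per] by simp
    let ?S = "point_nodes \<tau> \<sigma> i (Suc j)"
    have S: "point_nodes \<tau> \<sigma> k (Suc j) = ?S" and X: "circle_nodes \<tau> \<sigma> k (Suc j) = circle_nodes \<tau> \<sigma> i (Suc j)"
      by (simp_all add: point_nodes_def circle_nodes_def win)
    obtain \<zeta> where \<zeta>: "q i = Fin (s + \<zeta>)" "clifford_value (j div 2) ?S \<zeta>"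
      using rows i unfolding clifford_rows_def by blast
    obtain \<xi> where \<xi>: "q k = Fin (s + \<xi>)" "clifford_value (j div 2) ?S \<xi>"
      using rows k unfolding clifford_rows_def S[symmetric] by blast
    have good: "good_nodes (Suc (Suc j)) (insert \<sigma> (window \<tau> i (Suc j)))"
      using rows i unfolding clifford_rows_def by blast
    have "good_nodes (2 * Suc (j div 2)) ?S"
    proof (cases "even j")
      case True
      then show ?thesis using good by (simp add: point_nodes_def)
    next
      case False
      then have "2 * Suc (j div 2) = Suc j" by (auto elim: oddE)
      then show ?thesis
        using good_nodes_of_insert[OF good card_window_le] False by (simp add: point_nodes_def)
    qed
    then have "\<zeta> = \<xi>" using clifford_value_unique \<zeta> \<xi> by blast
    then have q: "q i = q k" using \<zeta> \<xi> by simp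
    define n where "n = Suc ((j - 1) div 2)"
    obtain K where K: "circle_with_center (d i) K"
      "\<And>\<zeta>. Fin (s + \<zeta>) \<in> K \<longleftrightarrow> clifford_value n (circle_nodes \<tau> \<sigma> i (Suc j)) \<zeta>"
      using clifford_rows_circle(2)[OF rows j i] unfolding n_def by blast
    obtain L where L: "circle_with_center (d k) L" "{p (k - 1), p (k + 1), q k} \<subseteq> L"
      "\<And>\<zeta>. Fin (s + \<zeta>) \<in> L \<longleftrightarrow> clifford_value n (circle_nodes \<tau> \<sigma> i (Suc j)) \<zeta>"
      using clifford_rows_circle(2)[OF rows j k] unfolding n_def X by blast
    \<comment> \<open>The defining points are finite, so agreement in finite points suffices even if
      the circles are lines.\<close>
    have "row_index j (k - 1)" "row_index j (k + 1)" using k by (auto simp: row_index_def)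
    then have "\<exists>\<zeta>. p (k - 1) = Fin (s + \<zeta>)" "\<exists>\<zeta>. p (k + 1) = Fin (s + \<zeta>)"
      using rows unfolding clifford_rows_def by blast+
    then have "{p (k - 1), p (k + 1), q k} \<subseteq> K" using L(2) K(2) L(3) \<xi>(1) by auto
    then have "center_of_circle_through (p (k - 1)) (p (k + 1)) (q k) (d i)"
      using K(1) unfolding center_of_circle_through_def by blast
    moreover have "center_of_circle_through (p (k - 1)) (p (k + 1)) (q k) (d k)"
      "\<exists>!c. center_of_circle_through (p (k - 1)) (p (k + 1)) (q k) c"
      using rows k unfolding clifford_rows_def by blast+
    ultimately show ?thesis using q by blast
  qed
  moreover have "row_index (Suc j) (int (Suc j))" by (simp add: row_index_def)
  ultimately have "constant_row (Suc j) q (q (int (Suc j)))" "constant_row (Suc j) d (d (int (Suc j)))"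
    unfolding constant_row_def by blast+
  then show ?thesis by blast
qed

section \<open>The first rows\<close>

text \<open>All circles with odd index and the circle about \<open>s'\<close> pass through
  \<open>s\<close>. For odd \<open>i\<close>, \<open>v i\<close> is the second intersection of the
  circle about \<open>t i\<close> with the one about \<open>s'\<close>; row 2 consists of the second
  intersections of neighbouring odd circles.\<close>

lemma clifford_rows_initial:
  fixes v t :: "int \<Rightarrow> complex"
  assumes data: "initial_data v t" and sing: "\<And>i. even i \<Longrightarrow> v i = s \<and> t i = s'"
    and step0: "step_defined 0 (\<lambda>i. Fin (v i)) (\<lambda>i. Fin (t i)) (\<lambda>i. Fin (v i))"
  defines "p \<equiv> new_points (\<lambda>i. Fin (v i)) (\<lambda>i. Fin (t i))"
  defines "c \<equiv> new_centers (\<lambda>i. Fin (v i)) p"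
  assumes step1: "step_defined 1 (\<lambda>i. Fin (v i)) c p"
  shows "clifford_rows s (\<lambda>i. t i - s) (s' - s) 1 (\<lambda>i. Fin (v i)) p c"
proof -
  \<comment> \<open>The circles with indices \<open>i\<close> and \<open>i + 1\<close> both pass
    through \<open>s\<close>, and the second has center \<open>s'\<close>.\<close>
  have odd_data: "t i \<noteq> s \<and> dist (t i) (v i) = dist (t i) s \<and> s' \<noteq> s \<and> dist s' (v i) = dist s' s"
    if "odd i" for i
  proof -
    obtain r where "r > 0" "{v (i - 1), v i, v (i + 1)} \<subseteq> sphere (t i) r"
      using data unfolding initial_data_def by blast
    moreover obtain r' where "r' > 0" "{v (i + 1 - 1), v (i + 1), v (i + 1 + 1)} \<subseteq> sphere (t (i + 1)) r'"
      using data unfolding initial_data_def by blast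
    moreover have "v (i - 1) = s" "v (i + 1) = s" "t (i + 1) = s'" using sing that by auto
    ultimately show ?thesis by auto
  qed
  have "\<exists>y. p i = Fin y \<and> y \<noteq> s \<and> dist (t (i - 1)) y = dist (t (i - 1)) s \<and>
      dist (t (i + 1)) y = dist (t (i + 1)) s" if "even i" for i
  proof -
    have "other_intersection (Fin (t (i - 1))) (Fin (t (i + 1))) (Fin (v i)) (p i)"
      unfolding p_def by (rule step_defined_new(2)[OF step0]) (use that in \<open>simp add: row_index_def\<close>)
    then show ?thesis using sing[OF that] by (auto simp: other_intersection_def)
  qed
  then obtain y where y: "\<And>i. even i \<Longrightarrow> p i = Fin (y i)" "\<And>i. even i \<Longrightarrow> y i \<noteq> s"
    "\<And>i. even i \<Longrightarrow> dist (t (i - 1)) (y i) = dist (t (i - 1)) s"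
    "\<And>i. even i \<Longrightarrow> dist (t (i + 1)) (y i) = dist (t (i + 1)) s"
    by metis
  have oi: "\<exists>!x. other_intersection (Fin (t (i - 1))) (Fin (t (i + 1))) (Fin s) x"
    "other_intersection (Fin (t (i - 1))) (Fin (t (i + 1))) (Fin s) (Fin (y i))" if "even i" for i
    using step_defined_new(1,2)[OF step0, of i] that sing y(1) unfolding p_def by (simp_all add: row_index_def)
  have tt: "t (i - 1) \<noteq> t (i + 1)" if "even i" for i
    using unique_other_intersection_centers[OF oi(1)[OF that]] by auto
  have cen: "\<exists>!x. center_of_circle_through (Fin (v (i - 1))) (Fin (v (i + 1))) (Fin (y i)) x"
    "center_of_circle_through (Fin (v (i - 1))) (Fin (v (i + 1))) (Fin (y i)) (c i)" if "even i" for i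
    using step_defined_new(3,4)[OF step0, of i] that y(1) unfolding c_def p_def by (simp_all add: row_index_def)
  have dist: "v (i - 1) \<noteq> v (i + 1)" "v (i - 1) \<noteq> y i" "v (i + 1) \<noteq> y i" if "even i" for i
    using unique_center_distinct[OF cen(1)[OF that]] by auto
  \<comment> \<open>Otherwise \<open>c (i + 1)\<close> is the center \<open>t (i + 2)\<close>, and the step from row 1 produces a
    point which is already in row 2.\<close>
  have vs: "v i \<noteq> s" if i: "odd i" for i
  proof
    assume "v i = s"
    have ev: "even (i + 1)" "even (i + 3)" and od: "odd (i + 2)" using i by auto
    have idx: "i + 1 - 1 = i" "i + 1 + 1 = i + 2" "i + 3 - 1 = i + 2" "i + 3 + 1 = i + 4"
      "i + 2 - 1 = i + 1" "i + 2 + 1 = i + 3" by simp_all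
    have "center_of_circle_through (Fin (v i)) (Fin (v (i + 2))) (Fin (y (i + 1))) (Fin (t (i + 2)))"
      unfolding center_of_circle_through_def
      using sphere_through[of s "t (i + 2)"] odd_data[OF od] y(4)[OF ev(1)] \<open>v i = s\<close>
      by (intro exI[of _ "Fin ` sphere (t (i + 2)) (dist (t (i + 2)) s)"]) (auto simp: add.assoc)
    then have c1: "c (i + 1) = Fin (t (i + 2))"
      using cen[OF ev(1)] unfolding idx by blast
    have s1: "\<exists>!x. other_intersection (c (i + 1)) (c (i + 3)) (Fin (v (i + 2))) x"
      "\<exists>!x. center_of_circle_through (p (i + 1)) (p (i + 3)) (new_points (\<lambda>i. Fin (v i)) c (i + 2)) x"
      "other_intersection (c (i + 1)) (c (i + 3)) (Fin (v (i + 2))) (new_points (\<lambda>i. Fin (v i)) c (i + 2))"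
      using step_defined_new(1,3,2)[OF step1, of "i + 2"] i unfolding idx by (simp_all add: row_index_def)
    obtain B where B: "circle_with_center (c (i + 3)) B" "Fin (v (i + 2)) \<in> B" "Fin (y (i + 3)) \<in> B"
      using cen(2)[OF ev(2)] unfolding idx center_of_circle_through_def by blast
    have A: "circle_with_center (c (i + 1)) (Fin ` sphere (t (i + 2)) (dist (t (i + 2)) s))"
      "Fin (v (i + 2)) \<in> Fin ` sphere (t (i + 2)) (dist (t (i + 2)) s)"
      "Fin (y (i + 3)) \<in> Fin ` sphere (t (i + 2)) (dist (t (i + 2)) s)"
      using sphere_through[of s "t (i + 2)"] odd_data[OF od] y(3)[OF ev(2)] unfolding c1 idx by auto
    have "Fin (y (i + 3)) \<noteq> Fin (v (i + 2))" using dist(2)[OF ev(2)] unfolding idx by simp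
    then have "other_intersection (c (i + 1)) (c (i + 3)) (Fin (v (i + 2))) (Fin (y (i + 3)))"
      using A B unfolding other_intersection_def by blast
    then have "new_points (\<lambda>i. Fin (v i)) c (i + 2) = Fin (y (i + 3))" using s1 by blast
    then show False
      using unique_center_distinct(3) s1(2) unfolding y(1)[OF ev(1)] y(1)[OF ev(2)] by metis
  qed
  \<comment> \<open>Otherwise the circle about \<open>t i\<close> also contains
    \<open>v (i + 2)\<close>, which is then the new point \<open>y (i + 1)\<close>. The next circle
    would be drawn through coinciding points.\<close>
  have ts: "t i \<noteq> s'" if i: "odd i" for i
  proof
    assume "t i = s'"
    have ev: "even (i + 1)" and od: "odd (i + 2)" using i by auto
    have idx: "i + 1 - 1 = i" "i + 1 + 1 = i + 2" by simp_all
    have "other_intersection (Fin (t i)) (Fin (t (i + 2))) (Fin s) (Fin (v (i + 2)))"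
      unfolding other_intersection_def
      using sphere_through[of s "t (i + 2)"] sphere_through[of s "t i"] odd_data[OF od] odd_data[OF i] vs[OF od] \<open>t i = s'\<close>
      by (intro exI[of _ "Fin ` sphere (t (i + 2)) (dist (t (i + 2)) s)"] exI[of _ "Fin ` sphere (t i) (dist (t i) s)"]) auto
    then have "v (i + 2) = y (i + 1)" using oi[OF ev] unfolding idx by blast
    then show False using dist(3)[OF ev] unfolding idx by simp
  qed
  have d0: "dist (b - s) (x - s) = norm (b - s)" if "dist b x = dist b s" for b x
    using that by (simp add: dist_norm)
  show ?thesis
    unfolding clifford_rows_def
  proof (intro conjI allI impI)
    fix i assume "row_index 1 i"
    then have i: "odd i" by (simp add: row_index_def)
    have "clifford_value 0 {t i - s, s' - s} (v i - s)"
      by (rule clifford_value_two_circles) (use odd_data[OF i] vs[OF i] ts[OF i] d0 in auto)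
    then have "clifford_value ((1 - 1) div 2) (point_nodes (\<lambda>i. t i - s) (s' - s) i 1) (v i - s)"
      by (simp add: point_nodes_def window_def insert_commute lessThan_Suc)
    then show "\<exists>\<zeta>. Fin (v i) = Fin (s + \<zeta>) \<and>
        clifford_value ((1 - 1) div 2) (point_nodes (\<lambda>i. t i - s) (s' - s) i 1) \<zeta>"
      by (intro exI[of _ "v i - s"]) simp
  next
    fix i assume "row_index (Suc 1) i"
    then have i: "even i" by (simp add: row_index_def)
    then have od: "odd (i - 1)" "odd (i + 1)" by auto
    have w: "window (\<lambda>i. t i - s) i (Suc 1) = {t (i - 1) - s, t (i + 1) - s}"
      using window_Suc_Suc[of "\<lambda>i. t i - s" i 0] by (simp add: window_def)
    have "clifford_value 0 {t (i - 1) - s, t (i + 1) - s} (y i - s)"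
      by (rule clifford_value_two_circles)
        (use odd_data[OF od(1)] odd_data[OF od(2)] y(2-4)[OF i] tt[OF i] d0 in auto)
    then have "clifford_value (1 div 2) (point_nodes (\<lambda>i. t i - s) (s' - s) i (Suc 1)) (y i - s)"
      by (simp add: point_nodes_def w[simplified])
    then show "\<exists>\<zeta>. p i = Fin (s + \<zeta>) \<and>
        clifford_value (1 div 2) (point_nodes (\<lambda>i. t i - s) (s' - s) i (Suc 1)) \<zeta>"
      using y(1)[OF i] by (intro exI[of _ "y i - s"]) simp
    have "ang (t (i - 1) - s) \<noteq> ang (t (i + 1) - s)"
      by (rule clifford_value_two_circles(2)[of _ _ "y i - s"])
        (use odd_data[OF od(1)] odd_data[OF od(2)] y(2-4)[OF i] tt[OF i] d0 in auto)
    moreover have "ang (t k - s) \<noteq> ang (s' - s)" if "odd k" for k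
      by (rule clifford_value_two_circles(2)[of _ _ "v k - s"])
        (use odd_data[OF that] vs[OF that] ts[OF that] d0 in auto)
    then have "ang (t (i - 1) - s) \<noteq> ang (s' - s)" "ang (t (i + 1) - s) \<noteq> ang (s' - s)"
      using od by blast+
    ultimately show "good_nodes (Suc (Suc 1)) (insert (s' - s) (window (\<lambda>i. t i - s) i (Suc 1)))"
      unfolding w good_nodes_def
      using odd_data[OF od(1)] odd_data[OF od(2)] by (auto simp: card_insert_if)
    show "\<exists>!x. center_of_circle_through (Fin (v (i - 1))) (Fin (v (i + 1))) (p i) x"
      "center_of_circle_through (Fin (v (i - 1))) (Fin (v (i + 1))) (p i) (c i)"
      using cen[OF i] y(1)[OF i] by simp_all
  qed
qed

section \<open>Running the dynamics up to row m\<close>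

text \<open>Sorts a state into intersection points and centers, both of the row \<open>j\<close> and of the row
  \<open>j + 1\<close>: the letters \<open>z\<close> and \<open>w\<close> swap their roles from row to row.\<close>

fun letters :: "nat \<Rightarrow> state \<Rightarrow> state" where
  "letters j (z\<^sub>0, w\<^sub>0, z\<^sub>1, w\<^sub>1) = (if even j then (z\<^sub>0, w\<^sub>0, w\<^sub>1, z\<^sub>1) else (w\<^sub>0, z\<^sub>0, z\<^sub>1, w\<^sub>1))"

lemma T_letters:
  assumes "T j S = Some S'" "letters j S = (p, c, q, d)"
  shows "step_defined j p d q"
    "letters (Suc j) S' = (q, d, new_points p d, new_centers q (new_points p d))"
proof -
  obtain z\<^sub>0 w\<^sub>0 z\<^sub>1 w\<^sub>1 where "S = (z\<^sub>0, w\<^sub>0, z\<^sub>1, w\<^sub>1)" by (cases S)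
  then show "step_defined j p d q"
    "letters (Suc j) S' = (q, d, new_points p d, new_centers q (new_points p d))"
    using assms by (auto simp: T_def Let_def split: if_splits)
qed

lemma T_iter_prefix: "T_iter (l + n) S\<^sub>0 = Some S \<Longrightarrow> \<exists>R. T_iter l S\<^sub>0 = Some R"
proof (induction n arbitrary: S)
  case 0
  then show ?case by (metis add_0_right)
next
  case (Suc n)
  then show ?case
    unfolding add_Suc_right T_iter.simps(2) Option.bind_eq_Some_conv by blast
qed

lemma T_iter_clifford_rows:
  assumes base: "\<And>S p c q d. T_iter 1 S\<^sub>0 = Some S \<Longrightarrow> letters 1 S = (p, c, q, d) \<Longrightarrow>
      clifford_rows s \<tau> \<sigma> 1 p q d"
    and "T_iter (Suc k) S\<^sub>0 = Some S" "letters (Suc k) S = (p, c, q, d)"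
  shows "clifford_rows s \<tau> \<sigma> (Suc k) p q d"
  using assms(2,3)
proof (induction k arbitrary: S p c q d)
  case 0
  then show ?case using base by simp
next
  case (Suc k)
  obtain R where R: "T_iter (Suc k) S\<^sub>0 = Some R" "T (Suc k) R = Some S"
    using Suc.prems(1) unfolding T_iter.simps(2)[of "Suc k"] Option.bind_eq_Some_conv by blast
  obtain p' c' q' d' where l: "letters (Suc k) R = (p', c', q', d')" by (cases "letters (Suc k) R")
  have "clifford_rows s \<tau> \<sigma> (Suc k) p' q' d'" by (rule Suc.IH[OF R(1) l])
  then have "clifford_rows s \<tau> \<sigma> (Suc (Suc k)) q' (new_points p' d') (new_centers q' (new_points p' d'))"
    by (rule clifford_rows_step) (use T_letters(1)[OF R(2) l] in simp_all)
  then show ?case using T_letters(2)[OF R(2) l] Suc.prems(2) by simp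
qed

theorem theorem8p4:
  fixes m :: nat and s s' :: complex and v t :: "int \<Rightarrow> complex"
    and z w z\<^sub>m w\<^sub>m :: row
  assumes "m \<ge> 3"
    and "initial_data v t"
    and "closed_data (2 * m) v t"
    and "\<forall>i. even i \<longrightarrow> v i = s \<and> t i = s'"
    and "T_iter (m - 1) (initial_state v t) = Some (z, w, z\<^sub>m, w\<^sub>m)"
  shows "\<exists>s'' s'''. constant_row m z\<^sub>m s'' \<and> constant_row m w\<^sub>m s'''"
proof -
  let ?S = "initial_state v t" and ?v = "\<lambda>i. Fin (v i)" and ?t = "\<lambda>i. Fin (t i)"
  let ?\<tau> = "\<lambda>i. t i - s" and ?\<sigma> = "s' - s"
  obtain k where "m = 3 + k" using assms(1) le_Suc_ex by blast
  then have m: "m = Suc (Suc (Suc k))" and m1: "m - 1 = Suc (Suc k)" by simp_all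
  \<comment> \<open>Since \<open>m \<ge> 3\<close>, at least two steps are well defined;
    nondegeneracy of the first rows relies on both.\<close>
  have "\<exists>S. T_iter 2 ?S = Some S"
    using T_iter_prefix[of 2 k ?S] assms(5) m by (simp add: numeral_2_eq_2)
  then obtain S1 S2 where S: "T_iter 1 ?S = Some S1" "T 0 ?S = Some S1" "T 1 S1 = Some S2"
    by (cases "T 0 ?S") (auto simp: numeral_2_eq_2)
  have l0: "letters 0 ?S = (?v, ?t, ?v, ?t)" by (simp add: initial_state_def)
  note T0 = T_letters[OF S(2) l0]
  note T1 = T_letters[OF S(3) T0(2)[folded One_nat_def]]
  have base: "clifford_rows s ?\<tau> ?\<sigma> 1 ?v (new_points ?v ?t) (new_centers ?v (new_points ?v ?t))"
    by (rule clifford_rows_initial) (use assms(2,4) T0(1) T1(1) in auto)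
  obtain p c q d where l: "letters (m - 1) (z, w, z\<^sub>m, w\<^sub>m) = (p, c, q, d)"
    by (cases "letters (m - 1) (z, w, z\<^sub>m, w\<^sub>m)")
  have rows: "clifford_rows s ?\<tau> ?\<sigma> (Suc (Suc k)) p q d"
    by (rule T_iter_clifford_rows[of ?S, OF _ assms(5)[unfolded m1] l[unfolded m1]])
      (use base S(1) T0(2) in simp)
  \<comment> \<open>The period \<open>2 * m\<close> fits row \<open>m\<close>, whose windows run
    through all odd indices modulo \<open>2 * m\<close>.\<close>
  have per: "?\<tau> (i + 2 * int (Suc (Suc (Suc k)))) = ?\<tau> i" for i
    using assms(3) m by (simp add: closed_data_def)
  have "\<exists>a b. constant_row m q a \<and> constant_row m d b"
    unfolding m by (rule clifford_rows_singular[OF rows _ per]) simp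
  \<comment> \<open>\<open>letters\<close> only exchanges \<open>z\<close> and \<open>w\<close>
    according to parity, so \<open>q\<close> and \<open>d\<close> are the two rows in
    question.\<close>
  then show ?thesis using l by (auto split: if_splits)
qed

end
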